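(* Fix $s_{\max}>0$. For each $N\in\mathbb N$ let $N_B(N)\ge \lfloor N s_{\max}\rfloor$ and let $E^{(N)}_1,\dots,E^{(N)}_{N_B(N)}$ be real numbers linearly independent over $\mathbb Q$ with weights $d^{(N)}_1,\dots,d^{(N)}_{N_B(N)}>0$. Define $(\Delta Z_N)^2=\sum_{k=1}^N(d_k^{(N)})^2$ and, for $s\in[0,s_{\max}]$, the random process $$W^N_s=\frac{1}{\Delta Z_N}\sum_{j=1}^{\lfloor Ns\rfloor}d^{(N)}_je^{-itE^{(N)}_j},$$ where $t$ is a random time distributed according to the infinite time average. Assume (a) there is $q>1$ such that $\sum_{k=1}^N (d_k^{(N)})^{2q}/\big(\sum_{k=1}^N (d_k^{(N)})^2\big)^q\to0$ as $N\to\infty$, and (b) for all $s,h\ge0$ with $s+h\le s_{\max}$, $$\lim_{N\to\infty}R_1^N(h,s)=h,\qquad R_1^N(h,s):=\frac{\sum_{k=\lfloor Ns\rfloor+1}^{\lfloor N(s+h)\rfloor}(d_k^{(N)})^2}{\sum_{k=1}^N(d_k^{(N)})^2}.$$ Then $W^N$ converges to a planar Wiener process in the sense of finite-dimensional distributions: for every $0\le s_0<s_1<\dots<s_m\le s_{\max}$ the increments $W^N_{s_i}-W^N_{s_{i-1}}$, $i=1,\dots,m$, are mutually independent for every $N$, and each $W^N_{s+h}-W^N_s$ converges in distribution to the isotropic Gaussian on $\mathbb R^2\cong\mathbb C$ with density $\frac{1}{\pi h}e^{-\|\boldsymbol x\|^2/h}$ (so that, after the time rescaling $s=2s'$, $\mathrm{Prob}(|W_{s'+h}-W_{s'}|\le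 r)=\frac1h\int_0^r u\,e^{-u^2/(2h)}du$).
   Context: Infinite time average: $\overline{f(t)}:=\lim_{T\to\infty}\frac1T\int_0^Tf(t)\,dt$; a random variable $F(t)$ with "$t$ distributed according to the infinite time average" has as law the limit as $T\to\infty$ of the law of $F(t)$ with $t$ uniform on $[0,T]$. *)

theory Defs
  imports "HOL-Probability.Probability"
begin

text \<open>Law of F(t) when t is distributed according to the infinite time average:
  the weak limit, as T tends to infinity, of the law of F(t) with t uniform on [0,T].
  Weak convergence is tested against bounded continuous real functions.\<close>
definition time_avg_law :: "(real \<Rightarrow> 'a::metric_space) \<Rightarrow> 'a measure \<Rightarrow> bool" where
  "time_avg_law F \<mu> \<longleftrightarrow> prob_space \<mu> \<and> sets \<mu> = sets borel \<and>
     (\<forall>g::'a \<Rightarrow> real. continuous_on UNIV g \<and> bounded (range g) \<longrightarrow>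
        ((\<lambda>T. (LINT t:{0..T}|lborel. g (F t)) / T) \<longlongrightarrow> (\<integral>x. g x \<partial>\<mu>)) at_top)"

definition weak_conv_seq :: "(nat \<Rightarrow> 'a::metric_space measure) \<Rightarrow> 'a measure \<Rightarrow> bool" where
  "weak_conv_seq \<nu> \<gamma> \<longleftrightarrow>
     (\<forall>g::'a \<Rightarrow> real. continuous_on UNIV g \<and> bounded (range g) \<longrightarrow>
        (\<lambda>N. \<integral>x. g x \<partial>(\<nu> N)) \<longlonglongrightarrow> (\<integral>x. g x \<partial>\<gamma>))"

definition iso_gaussian :: "real \<Rightarrow> complex measure" where
  "iso_gaussian h = density lborel (\<lambda>z. ennreal (exp (- (cmod z)\<^sup>2 / h) / (pi * h)))"

definition W_proc :: "(nat \<Rightarrow> nat \<Rightarrow> real) \<Rightarrow> (nat \<Rightarrow> nat \<Rightarrow> real) \<Rightarrow> nat \<Rightarrow> real \<Rightarrow> real \<Rightarrow> complex" where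
  "W_proc d E N s t =
     (\<Sum>j = 1..nat \<lfloor>real N * s\<rfloor>. complex_of_real (d N j) * exp (- \<i> * complex_of_real (t * E N j)))
     / complex_of_real (sqrt (\<Sum>k = 1..N. (d N k)\<^sup>2))"

end

theory Submission
  imports Defs
begin

text \<open>By Stone-Weierstrass, trigonometric polynomials are dense on the torus, and by linear
  independence of the energies the time average annihilates every nontrivial character. Hence the
  phases have the same law under the infinite time average as independent uniform (Steinhaus)
  variables on the circle, and increments over disjoint index blocks become independent sums.
  The central limit theorem for these sums is proved with characteristic functions. Its Lindeberg
  condition follows from the asymptotic linearity of the variance, since a single
  weight is dominated by an arbitrarily short block.\<close>

section \<open>Trigonometric spans and Steinhaus variables\<close>

text \<open>The infinite time average is only a limit of uniform laws on [0, T], not a countably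
  additive probability on the time axis, so independence and a central limit theorem cannot be run
  on it directly. One Steinhaus family on a single probability space therefore serves as a model for
  every N: a continuous function of finitely many phases along the flow has the law of the same
  function of the random variables. Points of all finite tori are encoded in the one type
  \<open>nat => complex\<close>. In the plane, compactness is lost, and characters no longer
  approximate bounded continuous functions uniformly. Test functions are first made periodic by
  \<open>fold_square\<close>, at a cost that second moments bound uniformly in N. The factor 1/4 in
  the characteristic functions comes from the variance 1/2 of a uniform point of the circle in every
  direction: a sum of total squared weight h is compared with the Gaussian of variance h/2 per
  coordinate, whose characteristic function is exp(-|w|^2 h/4).\<close>

lemma tendsto_approx:
  fixes f :: "'a \<Rightarrow> real"
  assumes "\<And>e. e > 0 \<Longrightarrow> \<exists>g b. (g \<longlongrightarrow> b) F \<and> eventually (\<lambda>x. \<bar>f x - g x\<bar> \<le> e) F \<and> \<bar>b - a\<bar> \<le> e"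
  shows "(f \<longlongrightarrow> a) F"
proof (rule tendstoI)
  fix e :: real assume "e > 0"
  then have "e / 4 > 0" by simp
  from assms[OF this] obtain g b where g: "(g \<longlongrightarrow> b) F"
    "eventually (\<lambda>x. \<bar>f x - g x\<bar> \<le> e / 4) F" "\<bar>b - a\<bar> \<le> e / 4" by blast
  have "eventually (\<lambda>x. dist (g x) b < e / 4) F"
    using g(1) \<open>e / 4 > 0\<close> by (rule tendstoD)
  with g(2) show "eventually (\<lambda>x. dist (f x) a < e) F"
  proof eventually_elim
    case (elim x)
    with g(3) \<open>e > 0\<close> show ?case unfolding dist_real_def by linarith
  qed
qed

lemma norm_integral_le:
  fixes f :: "'a \<Rightarrow> 'b::{banach, second_countable_topology}"
  assumes "integrable M f" "integrable M g" "\<And>x. norm (f x) \<le> g x"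
  shows "norm (\<integral>x. f x \<partial>M) \<le> (\<integral>x. g x \<partial>M)"
proof -
  have "norm (\<integral>x. f x \<partial>M) \<le> (\<integral>x. norm (f x) \<partial>M)" by (rule integral_norm_bound)
  also have "\<dots> \<le> (\<integral>x. g x \<partial>M)" using assms by (intro integral_mono integrable_norm)
  finally show ?thesis .
qed

lemma (in prob_space) expectation_diff_le:
  fixes f g :: "'a \<Rightarrow> real"
  assumes "integrable M f" "integrable M g" "\<And>x. \<bar>f x - g x\<bar> \<le> e"
  shows "\<bar>expectation f - expectation g\<bar> \<le> e"
  using norm_integral_le[of M "\<lambda>x. f x - g x" "\<lambda>_. e"] assms by (simp add: prob_space)

text \<open>The complex coefficient \<open>c\<close> yields real and imaginary parts of a character
  at once and absorbs real scalars, so two rules suffice for a real span. The functions are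
  real-valued because the Stone-Weierstrass theorem is applied to real functions.\<close>

inductive_set re_span :: "('x \<Rightarrow> complex) set \<Rightarrow> ('x \<Rightarrow> real) set" for X where
  base: "\<phi> \<in> X \<Longrightarrow> (\<lambda>x. Re (c * \<phi> x)) \<in> re_span X"
| add: "f \<in> re_span X \<Longrightarrow> g \<in> re_span X \<Longrightarrow> (\<lambda>x. f x + g x) \<in> re_span X"

text \<open>Closure under products rests on Re a * Re b = Re (a * b + a * cnj b) / 2.\<close>
lemma re_span_mult:
  assumes X: "\<And>\<phi> \<psi>. \<phi> \<in> X \<Longrightarrow> \<psi> \<in> X \<Longrightarrow> (\<lambda>x. \<phi> x * \<psi> x) \<in> X"
    "\<And>\<phi>. \<phi> \<in> X \<Longrightarrow> (\<lambda>x. cnj (\<phi> x)) \<in> X"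
    and "f \<in> re_span X" "g \<in> re_span X"
  shows "(\<lambda>x. f x * g x) \<in> re_span X"
  using assms(3)
proof induction
  case (base \<phi> c)
  show ?case using assms(4)
  proof induction
    case (base \<psi> c')
    have "(\<lambda>x. Re (c * c' / 2 * (\<phi> x * \<psi> x)) + Re (c * cnj c' / 2 * (\<phi> x * cnj (\<psi> x)))) \<in> re_span X"
      using base \<open>\<phi> \<in> X\<close> X
      by (intro re_span.add re_span.base[of "\<lambda>x. \<phi> x * \<psi> x"] re_span.base[of "\<lambda>x. \<phi> x * cnj (\<psi> x)"]) auto
    also have "(\<lambda>x. Re (c * c' / 2 * (\<phi> x * \<psi> x)) + Re (c * cnj c' / 2 * (\<phi> x * cnj (\<psi> x))))
      = (\<lambda>x. Re (c * \<phi> x) * Re (c' * \<psi> x))"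
      by (rule ext) (simp add: field_simps)
    finally show ?case .
  next
    case (add g1 g2)
    then show ?case using re_span.add by (fastforce simp: distrib_left)
  qed
next
  case (add f1 f2)
  then show ?case using re_span.add by (fastforce simp: distrib_right)
qed

lemma re_span_const:
  assumes "(\<lambda>_. 1) \<in> X" shows "(\<lambda>_. c) \<in> re_span X"
  using re_span.base[OF assms, of "complex_of_real c"] by simp

section \<open>Time averages of a single frequency\<close>

lemma integral_iexp:
  assumes "u \<noteq> 0" "0 \<le> T"
  shows "(LINT t:{0..T}|lborel. cis (u * t)) = (cis (u * T) - 1) / (\<i> * u)"
proof -
  have "((\<lambda>t. cis (u * t) / (\<i> * u)) has_vector_derivative cis (u * x)) (at x within {0..T})" for x
  proof -
    \<comment> \<open>The antiderivative is differentiated as a holomorphic function and then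
      restricted to the real line.\<close>
    have "((\<lambda>z. exp (\<i> * (of_real u * z)) / (\<i> * of_real u)) has_field_derivative
        exp (\<i> * (of_real u * of_real x))) (at (of_real x))"
      using assms(1) by (auto intro!: derivative_eq_intros simp: field_simps)
    from has_vector_derivative_real_field[OF this] show ?thesis
      by (simp add: cis_conv_exp)
  qed
  then have "integral\<^sup>L lborel (\<lambda>x. indicator {0..T} x *\<^sub>R cis (u * x)) =
     cis (u * T) / (\<i> * u) - cis (u * 0) / (\<i> * u)"
    using assms(2) by (intro integral_FTC_atLeastAtMost continuous_intros) auto
  then show ?thesis unfolding set_lebesgue_integral_def by (simp add: diff_divide_distrib)
qed

text \<open>For \<open>u \<noteq> 0\<close> the integral never exceeds 2/|u| however large
  \<open>T\<close> is, so dividing by \<open>T\<close> kills it; for \<open>u = 0\<close> the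
  integrand is 1.\<close>

lemma time_average_cis:
  "((\<lambda>T. (LINT t:{0..T}|lborel. cis (u * t)) / T) \<longlongrightarrow> (if u = 0 then 1 else 0)) at_top"
proof (cases "u = 0")
  case True
  have "eventually (\<lambda>T::real. 1 = (LINT t:{0..T}|lborel. cis (u * t)) / T) at_top"
    using eventually_gt_at_top[of 0]
    by eventually_elim (simp add: True set_lebesgue_integral_def scaleR_conv_of_real)
  then show ?thesis using True by (simp add: tendsto_eventually eventually_mono)
next
  case False
  have "((\<lambda>T. 2 / \<bar>u\<bar> / T) \<longlongrightarrow> 0) at_top" by real_asymp
  moreover have "eventually (\<lambda>T. cmod ((LINT t:{0..T}|lborel. cis (u * t)) / T) \<le> 2 / \<bar>u\<bar> / T) at_top"
    using eventually_gt_at_top[of 0]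
  proof eventually_elim
    case (elim T)
    have "cmod (cis (u * T) - 1) \<le> 2"
      using norm_triangle_ineq4[of "cis (u * T)" 1] by simp
    then show ?case using elim False
      by (simp add: integral_iexp norm_divide norm_mult divide_right_mono)
  qed
  ultimately show ?thesis using False by (simp add: Lim_null_comparison)
qed

text \<open>Uniform distribution on the unit circle is encoded by the vanishing of all positive moments.\<close>
locale steinhaus = prob_space +
  fixes Z :: "nat \<Rightarrow> 'a \<Rightarrow> complex"
  assumes indep: "indep_vars (\<lambda>_. borel) Z UNIV"
    and norm_Z [simp]: "cmod (Z k \<omega>) = 1"
    and moment: "n > 0 \<Longrightarrow> expectation (\<lambda>\<omega>. Z k \<omega> ^ n) = 0"
begin

lemma measurable_Z [measurable]: "Z k \<in> borel_measurable M"
  using indep unfolding indep_vars_def by auto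

text \<open>On the unit circle \<open>cnj (Z k \<omega>)\<close> is the inverse of
  \<open>Z k \<omega>\<close>, so the common powers cancel and only a pure power of
  \<open>Z k\<close> or its conjugate is left, with the difference of the exponents as its
  degree.\<close>

lemma mixed_moment: "expectation (\<lambda>\<omega>. Z k \<omega> ^ a * cnj (Z k \<omega>) ^ b) = (if a = b then 1 else 0)"
proof -
  have Zc: "Z k \<omega> * cnj (Z k \<omega>) = 1" for \<omega>
    by (simp add: complex_norm_square[symmetric])
  consider "a = b" | n where "n > 0" "a = b + n" | n where "n > 0" "b = a + n"
    by (metis less_imp_add_positive linorder_neqE_nat)
  then show ?thesis
  proof cases
    case 1
    then show ?thesis by (simp add: power_mult_distrib[symmetric] Zc prob_space)
  next
    case 2
    have "Z k \<omega> ^ a * cnj (Z k \<omega>) ^ b = (Z k \<omega> * cnj (Z k \<omega>)) ^ b * Z k \<omega> ^ n" for \<omega>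
      unfolding 2 by (simp add: power_add power_mult_distrib)
    then show ?thesis using 2 moment by (simp add: Zc)
  next
    case 3
    have "Z k \<omega> ^ a * cnj (Z k \<omega>) ^ b = (Z k \<omega> * cnj (Z k \<omega>)) ^ a * cnj (Z k \<omega> ^ n)" for \<omega>
      unfolding 3 by (simp add: power_add power_mult_distrib)
    then have "expectation (\<lambda>\<omega>. Z k \<omega> ^ a * cnj (Z k \<omega>) ^ b) = cnj (expectation (\<lambda>\<omega>. Z k \<omega> ^ n))"
      by (simp add: Zc Bochner_Integration.integral_cnj[symmetric]
          del: Bochner_Integration.integral_cnj)
    then show ?thesis using 3 moment by simp
  qed
qed

text \<open>Independence factors the expectation into mixed moments. The result is the integral of a
  torus character against Haar measure, to be matched with its time average.\<close>

lemma expectation_monomial: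
  assumes "finite K"
  shows "expectation (\<lambda>\<omega>. \<Prod>k\<in>K. Z k \<omega> ^ a k * cnj (Z k \<omega>) ^ b k)
    = (if \<forall>k\<in>K. a k = b k then 1 else 0)"
proof -
  have "indep_vars (\<lambda>_. borel) (\<lambda>k \<omega>. Z k \<omega> ^ a k * cnj (Z k \<omega>) ^ b k) K"
    by (rule indep_vars_compose2[OF indep_vars_subset[OF indep]])
      (auto intro!: borel_measurable_continuous_onI continuous_intros)
  then have "expectation (\<lambda>\<omega>. \<Prod>k\<in>K. Z k \<omega> ^ a k * cnj (Z k \<omega>) ^ b k)
    = (\<Prod>k\<in>K. expectation (\<lambda>\<omega>. Z k \<omega> ^ a k * cnj (Z k \<omega>) ^ b k))"
    using assms
    by (intro indep_vars_lebesgue_integral)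
      (auto intro!: integrable_const_bound[where B = 1] simp: norm_mult norm_power indep_vars_def)
  also have "\<dots> = (if \<forall>k\<in>K. a k = b k then 1 else 0)"
    using assms by (auto simp: mixed_moment)
  finally show ?thesis .
qed

end

text \<open>Coordinates of a countable power of Lebesgue measure on [0, 1] are independent; wrapping
  them around the circle keeps independence, and the n-th moment is the integral of an exponential
  over n full periods.\<close>

lemma steinhaus_exists:
  obtains M and Z :: "nat \<Rightarrow> (nat \<Rightarrow> real) \<Rightarrow> complex" where "steinhaus M Z"
proof -
  define I :: "real measure" where "I = restrict_space lborel {0..1}"
  have "prob_space I" unfolding I_def
    by (rule prob_spaceI) (simp add: emeasure_restrict_space)
  then interpret I: prob_space I .
  interpret M: prob_space "PiM UNIV (\<lambda>_::nat. I)" by (rule prob_space_PiM) unfold_locales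
  define Z where "Z = (\<lambda>(k::nat) \<theta>. cis (2 * pi * \<theta> k :: real))"
  have meas [measurable]: "(\<lambda>x::real. cis (2 * pi * x)) \<in> borel_measurable I"
    unfolding I_def by (intro measurable_restrict_space1) (simp add: borel_measurable_continuous_onI continuous_intros)
  have "M.indep_vars (\<lambda>_. I) (\<lambda>k \<theta>. \<theta> k) UNIV"
    by (subst M.indep_vars_iff_distr_eq_PiM')
      (simp_all add: distr_PiM_component[OF I.prob_space_axioms] restrict_UNIV)
  then have "M.indep_vars (\<lambda>_. borel) Z UNIV"
    unfolding Z_def by (rule M.indep_vars_compose2) measurable
  moreover have "M.expectation (\<lambda>\<theta>. Z k \<theta> ^ n) = 0" if "n > 0" for k n
  proof -
    have "M.expectation (\<lambda>\<theta>. Z k \<theta> ^ n) = (\<integral>x. cis (2 * pi * x) ^ n \<partial>I)"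
      by (subst distr_PiM_component[of UNIV "\<lambda>_. I" k, symmetric])
        (auto simp: I.prob_space_axioms integral_distr Z_def)
    also have "\<dots> = (LINT x:{0..1}|lborel. cis (2 * pi * real n * x))"
      unfolding I_def set_lebesgue_integral_def
      by (subst integral_restrict_space) (simp_all add: Complex.DeMoivre mult_ac)
    also have "\<dots> = 0"
      using that cis_multiple_2pi[of "real n"] by (subst integral_iexp) (simp_all add: mult_ac)
    finally show ?thesis .
  qed
  ultimately have "steinhaus (PiM UNIV (\<lambda>_. I)) Z"
    by unfold_locales (auto simp: Z_def)
  then show ?thesis by (rule that)
qed

section \<open>Weyl equidistribution\<close>

text \<open>Two natural exponents replace one integer exponent. This gives polynomials in
  \<open>x k\<close> and \<open>cnj (x k)\<close>, continuous at every point and not only on the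
  torus, and reduces products and conjugates to arithmetic of exponents. On the torus only
  \<open>a k - b k\<close> matters.\<close>

definition torus_chars :: "nat set \<Rightarrow> ((nat \<Rightarrow> complex) \<Rightarrow> complex) set" where
  "torus_chars K = range (\<lambda>(a, b) x. \<Prod>k\<in>K. x k ^ a k * cnj (x k) ^ b k)"

lemma torus_charsI: "(\<lambda>x. \<Prod>k\<in>K. x k ^ a k * cnj (x k) ^ b k) \<in> torus_chars K"
  unfolding torus_chars_def by (rule range_eqI[where x = "(a, b)"]) simp

lemma torus_charsE:
  assumes "\<phi> \<in> torus_chars K"
  obtains a b where "\<phi> = (\<lambda>x. \<Prod>k\<in>K. x k ^ a k * cnj (x k) ^ b k)"
  using assms unfolding torus_chars_def by auto

lemma torus_chars_mult:
  assumes "\<phi> \<in> torus_chars K" "\<psi> \<in> torus_chars K"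
  shows "(\<lambda>x. \<phi> x * \<psi> x) \<in> torus_chars K"
proof -
  obtain a b where 1: "\<phi> = (\<lambda>x. \<Prod>k\<in>K. x k ^ a k * cnj (x k) ^ b k)" using assms(1) by (rule torus_charsE)
  obtain c e where 2: "\<psi> = (\<lambda>x. \<Prod>k\<in>K. x k ^ c k * cnj (x k) ^ e k)" using assms(2) by (rule torus_charsE)
  have "(\<lambda>x. \<phi> x * \<psi> x) = (\<lambda>x. \<Prod>k\<in>K. x k ^ (a k + c k) * cnj (x k) ^ (b k + e k))"
    unfolding 1 2 by (simp add: prod.distrib[symmetric] power_add mult_ac)
  then show ?thesis by (simp only: torus_charsI)
qed

lemma torus_chars_cnj:
  assumes "\<phi> \<in> torus_chars K"
  shows "(\<lambda>x. cnj (\<phi> x)) \<in> torus_chars K"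
proof -
  obtain a b where 1: "\<phi> = (\<lambda>x. \<Prod>k\<in>K. x k ^ a k * cnj (x k) ^ b k)" using assms(1) by (rule torus_charsE)
  have "(\<lambda>x. cnj (\<phi> x)) = (\<lambda>x. \<Prod>k\<in>K. x k ^ b k * cnj (x k) ^ a k)"
    unfolding 1 by (simp add: mult_ac)
  then show ?thesis by (simp only: torus_charsI)
qed

lemma torus_chars_one: "(\<lambda>_. 1) \<in> torus_chars K"
  using torus_charsI[of "\<lambda>_. 0" "\<lambda>_. 0" K] by simp

lemma torus_chars_coordinate:
  assumes "finite K" "k \<in> K"
  shows "(\<lambda>x. x k) \<in> torus_chars K"
proof -
  have "(\<Prod>j\<in>K. x j ^ of_bool (j = k) * cnj (x j) ^ 0) = x k" for x :: "nat \<Rightarrow> complex"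
    using assms prod.delta[of K k x] by (simp add: of_bool_def if_distrib[of "power _"] cong: if_cong)
  with torus_charsI[of "\<lambda>j. of_bool (j = k)" "\<lambda>_. 0" K] show ?thesis by simp
qed

lemma continuous_torus_char:
  assumes "\<phi> \<in> torus_chars K"
  shows "continuous_on UNIV \<phi>"
  using assms by (elim torus_charsE) (simp, intro continuous_intros continuous_on_product_coordinates)

lemma continuous_re_span_torus:
  assumes "f \<in> re_span (torus_chars K)"
  shows "continuous_on UNIV f"
  using assms by induction (auto intro!: continuous_intros continuous_torus_char)

text \<open>Tychonoff's theorem, moved from the abstract product topology to the topology of the
  function type. Infinitely many factors occur because points carry coordinates outside
  \<open>K\<close> as well.\<close>

lemma compact_PiE_UNIV:
  fixes S :: "nat \<Rightarrow> complex set"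
  assumes "\<And>k. compact (S k)"
  shows "compact {x. \<forall>k. x k \<in> S k}"
proof -
  have "compactin (product_topology (\<lambda>_. euclidean) UNIV) (PiE UNIV S)"
    using assms by (simp add: compactin_PiE compactin_euclidean_iff)
  then show ?thesis
    by (simp add: euclidean_product_topology compactin_euclidean_iff PiE_def Pi_def extensional_def)
qed

text \<open>Coordinates outside \<open>K\<close> are pinned to 1: the points considered are then
  determined by their coordinates in \<open>K\<close>, so the characters of \<open>K\<close>
  separate them, and the set stays compact.\<close>

lemma torus_dense:
  fixes H :: "(nat \<Rightarrow> complex) \<Rightarrow> real"
  assumes "finite K" "continuous_on UNIV H" "e > 0"
  obtains f where "f \<in> re_span (torus_chars K)"
    "\<And>x. (\<forall>k\<in>K. cmod (x k) = 1) \<Longrightarrow> (\<forall>k. k \<notin> K \<longrightarrow> x k = 1) \<Longrightarrow> \<bar>H x - f x\<bar> < e"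
proof -
  define S :: "(nat \<Rightarrow> complex) set" where "S = {x. \<forall>k. x k \<in> (if k \<in> K then sphere 0 1 else {1})}"
  interpret function_ring_on "re_span (torus_chars K)" S
  proof
    show "compact S" unfolding S_def by (rule compact_PiE_UNIV) auto
    show "\<exists>f\<in>re_span (torus_chars K). f x \<noteq> f y" if "x \<in> S" "y \<in> S" "x \<noteq> y" for x y
    proof -
      obtain k where k: "x k \<noteq> y k" using \<open>x \<noteq> y\<close> by (auto simp: fun_eq_iff)
      with that have "k \<in> K" unfolding S_def by (metis (mono_tags, lifting) mem_Collect_eq singletonD)
      with torus_chars_coordinate[OF \<open>finite K\<close>] have "(\<lambda>x. x k) \<in> torus_chars K" by blast
      then have *: "(\<lambda>x. Re (c * x k)) \<in> re_span (torus_chars K)" for c by (rule re_span.base)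
      \<comment> \<open>Some coordinate in \<open>K\<close> differs in its real or its imaginary
        part; the coefficients 1 and \<open>- \<i>\<close> extract these.\<close>
      show ?thesis
      proof (cases "Re (x k) = Re (y k)")
        case True
        with k have "Im (x k) \<noteq> Im (y k)" by (simp add: complex_eq_iff)
        with *[of "- \<i>"] show ?thesis by (intro bexI) auto
      next
        case False
        with *[of 1] show ?thesis by (intro bexI) auto
      qed
    qed
  qed (auto intro: re_span_mult re_span.add re_span_const torus_chars_mult torus_chars_cnj
        torus_chars_one continuous_on_subset[OF continuous_re_span_torus])
  obtain f where "f \<in> re_span (torus_chars K)" "\<forall>x\<in>S. \<bar>H x - f x\<bar> < e"
    using Stone_Weierstrass_basic[of H e] continuous_on_subset[OF assms(2)] assms(3) by auto
  then show ?thesis by (intro that[of f]) (auto simp: S_def)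
qed

section \<open>Time averages along the flow against Steinhaus expectations\<close>

lemma set_integral_const_bound:
  fixes f :: "real \<Rightarrow> real"
  assumes "T > 0" "set_integrable lborel {0..T} f" "\<And>t. \<bar>f t\<bar> \<le> e"
  shows "\<bar>(LINT t:{0..T}|lborel. f t) / T\<bar> \<le> e"
proof -
  have "\<bar>LINT t:{0..T}|lborel. f t\<bar> \<le> (LINT t:{0..T}|lborel. \<bar>f t\<bar>)"
    using set_integral_norm_bound[OF assms(2)] by simp
  also have "\<dots> \<le> (LINT t:{0..T}|lborel. e)"
    using assms by (intro set_integral_mono set_integrable_abs)
      (auto simp: set_integrable_def)
  also have "\<dots> = e * T" using assms(1) by (simp add: set_lebesgue_integral_def)
  finally show ?thesis using assms(1) by (simp add: field_simps)
qed

lemma set_integrable_Icc: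
  fixes f :: "real \<Rightarrow> 'b::euclidean_space"
  assumes "continuous_on UNIV f"
  shows "set_integrable lborel {a..b} f"
  using borel_integrable_compact[of "{a..b}" f] continuous_on_subset[OF assms]
  by (simp add: set_integrable_def)

context steinhaus
begin

lemma measurable_Z_vector [measurable]: "(\<lambda>\<omega> k. Z k \<omega>) \<in> borel_measurable M"
  by (rule measurable_coordinatewise_then_product) simp

text \<open>\<open>g\<close> may be unbounded, but the variables take values in an infinite product
  of circles, which is compact, and there \<open>g\<close> is bounded.\<close>

lemma integrable_continuous_Z:
  assumes "continuous_on UNIV (g :: (nat \<Rightarrow> complex) \<Rightarrow> 'b::{banach, second_countable_topology})"
  shows "integrable M (\<lambda>\<omega>. g (\<lambda>k. Z k \<omega>))"
proof -
  have "compact {x :: nat \<Rightarrow> complex. \<forall>k. x k \<in> sphere 0 1}"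
    by (rule compact_PiE_UNIV) auto
  then have "bounded (g ` {x. \<forall>k. x k \<in> sphere 0 1})"
    using assms by (intro compact_imp_bounded compact_continuous_image) (auto intro: continuous_on_subset)
  then obtain B where "\<And>x. (\<forall>k. cmod (x k) = 1) \<Longrightarrow> norm (g x) \<le> B"
    unfolding bounded_iff by auto
  then show ?thesis
    by (intro integrable_const_bound[where B = B])
      (auto intro!: measurable_compose[OF measurable_Z_vector] borel_measurable_continuous_onI assms)
qed

text \<open>A torus character evaluated along the flow is cis (u * t), where u vanishes, by linear
  independence, only if the character is trivial.\<close>
lemma time_average_torus_char:
  assumes K: "finite K"
    and E: "\<And>q :: nat \<Rightarrow> int. (\<Sum>k\<in>K. of_int (q k) * E k) = 0 \<Longrightarrow> \<forall>k\<in>K. q k = 0"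
    and \<phi>: "\<phi> \<in> torus_chars K"
  shows "((\<lambda>T. (LINT t:{0..T}|lborel. \<phi> (\<lambda>k. cis (- (t * E k)))) / of_real T)
    \<longlongrightarrow> expectation (\<lambda>\<omega>. \<phi> (\<lambda>k. Z k \<omega>))) at_top"
proof -
  obtain a b where \<phi>_eq: "\<phi> = (\<lambda>x. \<Prod>k\<in>K. x k ^ a k * cnj (x k) ^ b k)"
    using \<phi> by (rule torus_charsE)
  \<comment> \<open>The flow has phase \<open>- (t * E k)\<close>, so a plain factor contributes
    \<open>- a k\<close> and a conjugated one \<open>+ b k\<close> to the frequency.\<close>
  define u where "u = (\<Sum>k\<in>K. of_int (int (b k) - int (a k)) * E k)"
  have "(\<Prod>k\<in>K. cis (- (t * E k)) ^ a k * cnj (cis (- (t * E k))) ^ b k) = cis (u * t)" for t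
  proof -
    have "cis (- (t * E k)) ^ a k * cnj (cis (- (t * E k))) ^ b k
        = cis (of_int (int (b k) - int (a k)) * E k * t)" for k
      by (simp add: cis_cnj Complex.DeMoivre cis_mult) (simp add: algebra_simps)
    moreover have "(\<Prod>k\<in>K. cis (f k)) = cis (\<Sum>k\<in>K. f k)" for f
      using K by induction (auto simp: cis_mult)
    ultimately show ?thesis by (simp add: u_def sum_distrib_right)
  qed
  moreover have "u = 0 \<longleftrightarrow> (\<forall>k\<in>K. a k = b k)"
    using E[of "\<lambda>k. int (b k) - int (a k)"] unfolding u_def by auto
  ultimately show ?thesis
    using time_average_cis[of u] expectation_monomial[OF K, of a b] by (simp add: \<phi>_eq)
qed

lemma time_average_re_span:
  assumes K: "finite K"
    and E: "\<And>q :: nat \<Rightarrow> int. (\<Sum>k\<in>K. of_int (q k) * E k) = 0 \<Longrightarrow> \<forall>k\<in>K. q k = 0"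
    and f: "f \<in> re_span (torus_chars K)"
  shows "((\<lambda>T. (LINT t:{0..T}|lborel. f (\<lambda>k. cis (- (t * E k)))) / T)
    \<longlongrightarrow> expectation (\<lambda>\<omega>. f (\<lambda>k. Z k \<omega>))) at_top"
  using f
proof induction
  case (base \<phi> c)
  have cont: "continuous_on UNIV (\<lambda>t. \<phi> (\<lambda>k. cis (- (t * E k))))"
    by (rule continuous_on_compose2[OF continuous_torus_char[OF base]]) (auto intro!: continuous_intros)
  have "Re (c * ((LINT t:{0..T}|lborel. \<phi> (\<lambda>k. cis (- (t * E k)))) / of_real T))
    = (LINT t:{0..T}|lborel. Re (c * \<phi> (\<lambda>k. cis (- (t * E k))))) / T" for T
  proof -
    have "set_integrable lborel {0..T} (\<lambda>t. c * \<phi> (\<lambda>k. cis (- (t * E k))))"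
      by (intro set_integrable_Icc continuous_intros cont)
    then have "Re (LINT t:{0..T}|lborel. c * \<phi> (\<lambda>k. cis (- (t * E k))))
      = (LINT t:{0..T}|lborel. Re (c * \<phi> (\<lambda>k. cis (- (t * E k)))))"
      unfolding set_lebesgue_integral_def set_integrable_def by (subst integral_Re[symmetric]) auto
    moreover have "c * ((LINT t:{0..T}|lborel. \<phi> (\<lambda>k. cis (- (t * E k)))) / of_real T)
        = (LINT t:{0..T}|lborel. c * \<phi> (\<lambda>k. cis (- (t * E k)))) / of_real T"
      by simp
    ultimately show ?thesis by (metis Re_divide_of_real)
  qed
  moreover have "Re (c * expectation (\<lambda>\<omega>. \<phi> (\<lambda>k. Z k \<omega>))) = expectation (\<lambda>\<omega>. Re (c * \<phi> (\<lambda>k. Z k \<omega>)))"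
    using integrable_continuous_Z[OF continuous_torus_char[OF base]]
    by (subst integral_Re) (auto simp: integral_mult_right_zero)
  ultimately show ?case
    using tendsto_Re[OF tendsto_mult[OF tendsto_const[of c] time_average_torus_char[where E = E, OF K E base]]]
    by (simp only:)
next
  case (add f g)
  have cont: "continuous_on UNIV (\<lambda>t. h (\<lambda>k. cis (- (t * E k))))" if "h \<in> re_span (torus_chars K)" for h
    by (rule continuous_on_compose2[OF continuous_re_span_torus[OF that]]) (auto intro!: continuous_intros)
  from tendsto_add[OF add.IH] show ?case
    using add.hyps by (simp add: set_integral_add set_integrable_Icc cont integrable_continuous_Z
        continuous_re_span_torus add_divide_distrib)
qed

text \<open>Time averaging and expectation both have norm at most 1 for uniform distance on the
  torus, so replacing \<open>H\<close> by a nearby trigonometric polynomial costs at most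
  \<open>e\<close> on either side, uniformly in \<open>T\<close>.\<close>

theorem weyl_equidistribution:
  fixes H :: "(nat \<Rightarrow> complex) \<Rightarrow> real"
  assumes K: "finite K"
    and E: "\<And>q :: nat \<Rightarrow> int. (\<Sum>k\<in>K. of_int (q k) * E k) = 0 \<Longrightarrow> \<forall>k\<in>K. q k = 0"
    and H: "continuous_on UNIV H"
    and dep: "\<And>x y. (\<And>k. k \<in> K \<Longrightarrow> x k = y k) \<Longrightarrow> H x = H y"
  shows "((\<lambda>T. (LINT t:{0..T}|lborel. H (\<lambda>k. cis (- (t * E k)))) / T)
    \<longlongrightarrow> expectation (\<lambda>\<omega>. H (\<lambda>k. Z k \<omega>))) at_top"
proof (rule tendsto_approx)
  fix e :: real assume "e > 0"
  obtain f where f: "f \<in> re_span (torus_chars K)"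
    "\<And>x. (\<forall>k\<in>K. cmod (x k) = 1) \<Longrightarrow> (\<forall>k. k \<notin> K \<longrightarrow> x k = 1) \<Longrightarrow> \<bar>H x - f x\<bar> < e"
    using torus_dense[OF K H \<open>e > 0\<close>] by blast
  \<comment> \<open>The density estimate speaks only of points equal to 1 outside \<open>K\<close>,
    while the flow and the random point have other unit coordinates there. Both \<open>H\<close> and
    \<open>f\<close> ignore these coordinates, which carries the estimate over.\<close>
  have dep_f: "f x = f y" if "\<And>k. k \<in> K \<Longrightarrow> x k = y k" for x y
    using f(1) that by induction (auto elim!: torus_charsE intro!: arg_cong[where f = Re] prod.cong)
  have less: "\<bar>H x - f x\<bar> < e" if "\<forall>k. cmod (x k) = 1" for x
    using f(2)[of "\<lambda>k. if k \<in> K then x k else 1"] that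
      dep[of x "\<lambda>k. if k \<in> K then x k else 1"] dep_f[of x "\<lambda>k. if k \<in> K then x k else 1"]
    by simp
  have f_cont: "continuous_on UNIV f" by (rule continuous_re_span_torus[OF f(1)])
  have cont: "continuous_on UNIV (\<lambda>t. h (\<lambda>k. cis (- (t * E k))))" if "continuous_on UNIV h"
    for h :: "(nat \<Rightarrow> complex) \<Rightarrow> real"
    by (rule continuous_on_compose2[OF that]) (auto intro!: continuous_intros)
  have "eventually (\<lambda>T. \<bar>(LINT t:{0..T}|lborel. H (\<lambda>k. cis (- (t * E k)))) / T
      - (LINT t:{0..T}|lborel. f (\<lambda>k. cis (- (t * E k)))) / T\<bar> \<le> e) at_top"
    using eventually_gt_at_top[of 0]
  proof eventually_elim
    case (elim T)
    have "\<bar>(LINT t:{0..T}|lborel. H (\<lambda>k. cis (- (t * E k))) - f (\<lambda>k. cis (- (t * E k)))) / T\<bar> \<le> e"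
      using elim less by (intro set_integral_const_bound set_integrable_Icc continuous_intros cont H f_cont)
        (auto intro: less_imp_le)
    then show ?case
      by (simp add: set_integral_diff set_integrable_Icc cont H f_cont diff_divide_distrib)
  qed
  moreover have "\<bar>expectation (\<lambda>\<omega>. f (\<lambda>k. Z k \<omega>)) - expectation (\<lambda>\<omega>. H (\<lambda>k. Z k \<omega>))\<bar> \<le> e"
    using less[of "\<lambda>k. Z k _"]
    by (intro expectation_diff_le integrable_continuous_Z f_cont H) (auto simp: abs_minus_commute intro: less_imp_le)
  ultimately show "\<exists>g b. (g \<longlongrightarrow> b) at_top \<and>
      eventually (\<lambda>T. \<bar>(LINT t:{0..T}|lborel. H (\<lambda>k. cis (- (t * E k)))) / T - g T\<bar> \<le> e) at_top \<and>
      \<bar>b - expectation (\<lambda>\<omega>. H (\<lambda>k. Z k \<omega>))\<bar> \<le> e"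
    using time_average_re_span[OF K E f(1)] by blast
qed

end

section \<open>Levy continuity in the plane\<close>

definition plane_chars :: "(complex \<Rightarrow> complex) set" where
  "plane_chars = range (\<lambda>w z. cis (w \<bullet> z))"

lemma plane_chars_mult: "\<phi> \<in> plane_chars \<Longrightarrow> \<psi> \<in> plane_chars \<Longrightarrow> (\<lambda>x. \<phi> x * \<psi> x) \<in> plane_chars"
  unfolding plane_chars_def by (auto simp: cis_mult inner_add_left[symmetric])

lemma plane_chars_cnj: "\<phi> \<in> plane_chars \<Longrightarrow> (\<lambda>x. cnj (\<phi> x)) \<in> plane_chars"
  unfolding plane_chars_def by (auto simp: cis_cnj inner_minus_left[symmetric] simp del: inner_minus_left)

lemma plane_chars_one: "(\<lambda>_. 1) \<in> plane_chars"
  unfolding plane_chars_def by (rule range_eqI[where x = 0]) simp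

lemma sin_inner_re_span: "(\<lambda>z. a * sin (w \<bullet> z)) \<in> re_span plane_chars"
proof -
  have "(\<lambda>z. Re ((- \<i> * a) * cis (w \<bullet> z))) \<in> re_span plane_chars"
    by (rule re_span.base) (simp add: plane_chars_def)
  then show ?thesis by simp
qed

text \<open>The span is an algebra containing the sines of both rescaled coordinates, hence every
  polynomial in them. Polynomial approximation in the sines thereby becomes approximation by
  characters.\<close>

lemma polynomial_sin_re_span:
  assumes "real_polynomial_function p"
  shows "(\<lambda>z. p (Complex (sin (c * Re z)) (sin (c * Im z)))) \<in> re_span plane_chars"
  using assms
proof induction
  case (linear f)
  interpret bounded_linear f by fact
  have Cz: "Complex x y = x *\<^sub>R 1 + y *\<^sub>R \<i>" for x y by (simp add: complex_eq_iff)
  \<comment> \<open>A real-linear functional is fixed by its values at \<open>1\<close> and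
    \<open>\<i>\<close>; the frequencies \<open>c\<close> and \<open>c * \<i>\<close> select
    \<open>Re z\<close> and \<open>Im z\<close> in the inner product.\<close>
  have "f (Complex (sin (c * Re z)) (sin (c * Im z)))
     = f 1 * sin (complex_of_real c \<bullet> z) + f \<i> * sin ((c * \<i>) \<bullet> z)" for z
    unfolding Cz add scale by (simp add: inner_complex_def)
  then show ?case by (simp add: re_span.add sin_inner_re_span)
next
  case (const c)
  show ?case by (rule re_span_const[OF plane_chars_one])
next
  case (add f g)
  from re_span.add[OF add.IH] show ?case .
next
  case (mult f g)
  from re_span_mult[OF plane_chars_mult plane_chars_cnj mult.IH] show ?case .
qed

lemma measurable_plane_char [measurable]: "(\<lambda>z. cis (w \<bullet> z)) \<in> borel_measurable borel"
  by (intro borel_measurable_continuous_onI continuous_intros)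

lemma integrable_plane_char:
  assumes "prob_space M" "sets M = sets borel"
  shows "integrable M (\<lambda>z. cis (w \<bullet> z))"
proof -
  interpret prob_space M by fact
  show ?thesis
    using measurable_plane_char[of w] assms(2)
    by (intro integrable_const_bound[where B = 1]) (auto cong: measurable_cong_sets)
qed

lemma integrable_plane_re_span:
  assumes "prob_space M" "sets M = sets borel" "f \<in> re_span plane_chars"
  shows "integrable M f"
  using assms(3)
proof induction
  case (base \<phi> c)
  then show ?case
    using integrable_plane_char[OF assms(1,2)] by (auto simp: plane_chars_def simp del: times_complex.sel intro!: integrable_Re integrable_mult_right)
qed auto

lemma tendsto_integral_plane_re_span:
  assumes "\<And>n. prob_space (M n)" "\<And>n. sets (M n) = sets borel"
    and "prob_space L" "sets L = sets borel"
    and char: "\<And>w. (\<lambda>n. \<integral>z. cis (w \<bullet> z) \<partial>M n) \<longlonglongrightarrow> (\<integral>z. cis (w \<bullet> z) \<partial>L)"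
    and "f \<in> re_span plane_chars"
  shows "(\<lambda>n. \<integral>z. f z \<partial>M n) \<longlonglongrightarrow> (\<integral>z. f z \<partial>L)"
  using assms(6)
proof induction
  case (base \<phi> c)
  then obtain w where \<phi>: "\<phi> = (\<lambda>z. cis (w \<bullet> z))" by (auto simp: plane_chars_def)
  have "(\<integral>z. Re (c * \<phi> z) \<partial>P) = Re (c * (\<integral>z. \<phi> z \<partial>P))"
    if "prob_space P" "sets P = sets borel" for P
    using integrable_plane_char[OF that, of w] unfolding \<phi> by (subst integral_Re) auto
  with assms(1-4) tendsto_Re[OF tendsto_mult[OF tendsto_const[of c] char[of w]]] show ?case
    by (simp only: \<phi>)
next
  case (add f g)
  from tendsto_add[OF add.IH] show ?case
    using add.hyps assms(1-4) by (simp add: integrable_plane_re_span)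
qed

text \<open>Inside the square of half-width pi * L / 2 the map is the identity, while it factors through
  sines and so makes any function periodic.\<close>
definition fold_square :: "real \<Rightarrow> complex \<Rightarrow> complex" where
  "fold_square L z = Complex (L * arcsin (sin (Re z / L))) (L * arcsin (sin (Im z / L)))"

text \<open>Since \<open>1 \<le> pi / 2\<close>, the disc of radius \<open>L\<close> lies in the
  square on which \<open>arcsin\<close> inverts \<open>sin\<close>.\<close>

lemma fold_square_id:
  assumes "L > 0" "cmod z \<le> L"
  shows "fold_square L z = z"
proof -
  have *: "- (pi / 2) \<le> x / L \<and> x / L \<le> pi / 2" if "\<bar>x\<bar> \<le> cmod z" for x
  proof -
    have "\<bar>x / L\<bar> \<le> 1" using that assms by simp
    moreover have "1 \<le> pi / 2" using pi_ge_two by simp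
    ultimately show ?thesis by linarith
  qed
  have "arcsin (sin (Re z / L)) = Re z / L" "arcsin (sin (Im z / L)) = Im z / L"
    using *[OF abs_Re_le_cmod] *[OF abs_Im_le_cmod] by (auto intro: arcsin_sin)
  then show ?thesis using assms(1) by (simp add: fold_square_def)
qed

lemma continuous_arcsin_square:
  assumes "continuous_on UNIV (g :: complex \<Rightarrow> real)"
  shows "continuous_on (cbox (Complex (-1) (-1)) (Complex 1 1))
    (\<lambda>u. g (Complex (L * arcsin (Re u)) (L * arcsin (Im u))))"
  by (rule continuous_on_compose2[OF assms])
    (auto intro!: continuous_intros continuous_on_Complex simp: in_cbox_complex_iff)

text \<open>In the variables sin(Re z / L) and sin(Im z / L) the plane becomes the compact square
  [-1, 1]^2. A polynomial close to the transported function there gives an approximation uniform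
  over the whole plane.\<close>

lemma fold_square_approx:
  assumes "continuous_on UNIV (g :: complex \<Rightarrow> real)" "e > 0"
  obtains f where "f \<in> re_span plane_chars" "\<And>z. \<bar>g (fold_square L z) - f z\<bar> < e"
proof -
  obtain p where p: "real_polynomial_function p" "\<And>u. u \<in> cbox (Complex (-1) (-1)) (Complex 1 1) \<Longrightarrow>
    \<bar>g (Complex (L * arcsin (Re u)) (L * arcsin (Im u))) - p u\<bar> < e"
    using Stone_Weierstrass_real_polynomial_function[OF compact_cbox continuous_arcsin_square[OF assms(1)] assms(2)]
    by blast
  show ?thesis
  proof
    show "(\<lambda>z. p (Complex (sin (1 / L * Re z)) (sin (1 / L * Im z)))) \<in> re_span plane_chars"
      by (rule polynomial_sin_re_span[OF p(1)])
    show "\<bar>g (fold_square L z) - p (Complex (sin (1 / L * Re z)) (sin (1 / L * Im z)))\<bar> < e" for z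
      using p(2)[of "Complex (sin (1 / L * Re z)) (sin (1 / L * Im z))"]
      by (simp add: fold_square_def in_cbox_complex_iff)
  qed
qed

lemma measurable_fold_square [measurable]: "fold_square L \<in> borel_measurable borel"
proof -
  have "continuous_on UNIV (fold_square L)"
    \<comment> \<open>Multiplication by the constant \<open>inverse L\<close> is continuous without
      a side condition, so \<open>L = 0\<close> is included.\<close>
    unfolding fold_square_def divide_inverse
    by (intro continuous_on_Complex continuous_intros) auto
  then show ?thesis by (rule borel_measurable_continuous_onI)
qed

text \<open>The second-moment bound supplies tightness.\<close>
theorem plane_levy_continuity:
  fixes M :: "nat \<Rightarrow> complex measure"
  assumes M: "\<And>n. prob_space (M n)" "\<And>n. sets (M n) = sets borel"
    and L: "prob_space L" "sets L = sets borel"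
    and char: "\<And>w. (\<lambda>n. \<integral>z. cis (w \<bullet> z) \<partial>M n) \<longlonglongrightarrow> (\<integral>z. cis (w \<bullet> z) \<partial>L)"
    and moment: "\<And>n. integrable (M n) (\<lambda>z. (cmod z)\<^sup>2)" "\<And>n. (\<integral>z. (cmod z)\<^sup>2 \<partial>M n) \<le> C"
  shows "weak_conv_seq M L"
  unfolding weak_conv_seq_def
proof (intro allI impI)
  fix g :: "complex \<Rightarrow> real" assume "continuous_on UNIV g \<and> bounded (range g)"
  then have g: "continuous_on UNIV g" and "bounded (range g)" by auto
  then obtain B where B: "\<And>z. \<bar>g z\<bar> \<le> B" unfolding bounded_iff by auto
  have B0: "B \<ge> 0" using B[of 0] by linarith
  have g_meas [measurable]: "g \<in> borel_measurable borel" using g by (rule borel_measurable_continuous_onI)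
  have int: "integrable P (\<lambda>z. g (h z))" if "prob_space P" "sets P = sets borel" "h \<in> borel_measurable borel" for P h
  proof -
    interpret prob_space P by fact
    have "(\<lambda>z. g (h z)) \<in> borel_measurable P" using that(2,3) g_meas
      by (simp cong: measurable_cong_sets)
    then show ?thesis by (intro integrable_const_bound[where B = B]) (auto simp: B)
  qed
  interpret L: prob_space L by fact
  show "(\<lambda>N. \<integral>x. g x \<partial>M N) \<longlonglongrightarrow> (\<integral>x. g x \<partial>L)"
  proof (rule tendsto_approx)
    fix e :: real assume "e > 0"
    \<comment> \<open>No moment bound is assumed for the limit law, so its folding error is made
      small by dominated convergence. For the laws \<open>M k\<close> the bound
      \<open>2 * B * C / (real n)\<^sup>2\<close> is uniform in \<open>k\<close>; one
      \<open>n\<close> is then chosen to serve both.\<close>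
    have "(\<lambda>n. \<integral>z. g (fold_square (real n) z) \<partial>L) \<longlonglongrightarrow> (\<integral>z. g z \<partial>L)"
    proof (rule integral_dominated_convergence[where w = "\<lambda>_. B"])
      show "AE z in L. (\<lambda>n. g (fold_square (real n) z)) \<longlonglongrightarrow> g z"
      proof (rule AE_I2, rule tendsto_eventually)
        fix z
        show "eventually (\<lambda>n. g (fold_square (real n) z) = g z) sequentially"
          using eventually_ge_at_top[of "nat \<lceil>cmod z\<rceil> + 1"]
        proof eventually_elim
          case (elim n)
          then have "real n > 0" "cmod z \<le> real n" by linarith+
          then show ?case by (simp add: fold_square_id)
        qed
      qed
    qed (use L(2) B int[OF L] in \<open>auto cong: measurable_cong_sets\<close>)
    then have "eventually (\<lambda>n. dist (\<integral>z. g (fold_square (real n) z) \<partial>L) (\<integral>z. g z \<partial>L) < e / 2) sequentially"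
      using \<open>e > 0\<close> by (intro tendstoD) auto
    moreover have "(\<lambda>n. 2 * B * C / (real n)\<^sup>2) \<longlonglongrightarrow> 0" by real_asymp
    then have "eventually (\<lambda>n. 2 * B * C / (real n)\<^sup>2 < e / 2) sequentially"
      using \<open>e > 0\<close> by (intro order_tendstoD) auto
    ultimately have "eventually (\<lambda>n. n > 0 \<and> dist (\<integral>z. g (fold_square (real n) z) \<partial>L) (\<integral>z. g z \<partial>L) < e / 2
        \<and> 2 * B * C / (real n)\<^sup>2 < e / 2) sequentially"
      using eventually_gt_at_top[of 0] by eventually_elim auto
    then obtain n where n: "n > 0" "dist (\<integral>z. g (fold_square (real n) z) \<partial>L) (\<integral>z. g z \<partial>L) < e / 2"
        "2 * B * C / (real n)\<^sup>2 < e / 2"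
      by (auto simp: eventually_sequentially)
    obtain f where f: "f \<in> re_span plane_chars" "\<And>z. \<bar>g (fold_square (real n) z) - f z\<bar> < e / 2"
      using fold_square_approx[OF g, of "e / 2" "real n"] \<open>e > 0\<close> by auto
    have close: "\<bar>(\<integral>z. g (fold_square (real n) z) \<partial>P) - (\<integral>z. f z \<partial>P)\<bar> \<le> e / 2"
      if P: "prob_space P" "sets P = sets borel" for P
    proof -
      interpret prob_space P by fact
      show ?thesis
        using int[OF P] integrable_plane_re_span[OF P f(1)] f(2)
        by (intro expectation_diff_le) (auto intro: less_imp_le)
    qed
    have tail: "\<bar>(\<integral>z. g z \<partial>M k) - (\<integral>z. g (fold_square (real n) z) \<partial>M k)\<bar> \<le> e / 2" for k
    proof -
      \<comment> \<open>Chebyshev's inequality in pointwise form: there is no error inside the disc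
        of radius \<open>n\<close>, and outside it the trivial bound \<open>2 * B\<close> is
        multiplied by a quotient that is at least 1.\<close>
      have pt: "\<bar>g z - g (fold_square (real n) z)\<bar> \<le> 2 * B / (real n)\<^sup>2 * (cmod z)\<^sup>2" for z
      proof (cases "cmod z \<le> real n")
        case True
        then show ?thesis using n(1) B0 by (simp add: fold_square_id)
      next
        case False
        then have "1 \<le> (cmod z)\<^sup>2 / (real n)\<^sup>2" using n(1) by (simp add: power_mono)
        then have "2 * B * 1 \<le> 2 * B * ((cmod z)\<^sup>2 / (real n)\<^sup>2)" using B0 by (intro mult_left_mono) auto
        with B[of z] B[of "fold_square (real n) z"] show ?thesis by simp
      qed
      have i: "integrable (M k) (\<lambda>z. g (fold_square (real n) z))" "integrable (M k) g"
        using int[OF M, of "\<lambda>z. z"] int[OF M] by auto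
      then have "\<bar>(\<integral>z. g z \<partial>M k) - (\<integral>z. g (fold_square (real n) z) \<partial>M k)\<bar>
         \<le> (\<integral>z. 2 * B / (real n)\<^sup>2 * (cmod z)\<^sup>2 \<partial>M k)"
        using norm_integral_le[of "M k" "\<lambda>z. g z - g (fold_square (real n) z)"
          "\<lambda>z. 2 * B / (real n)\<^sup>2 * (cmod z)\<^sup>2"] pt moment(1) by simp
      also have "\<dots> \<le> 2 * B / (real n)\<^sup>2 * C"
        using moment(2)[of k] B0 by (auto intro!: mult_left_mono divide_right_mono)
      finally show ?thesis using n(3) by simp
    qed
    have "(\<lambda>k. \<integral>z. f z \<partial>M k) \<longlonglongrightarrow> (\<integral>z. f z \<partial>L)"
      using M L char f(1) by (rule tendsto_integral_plane_re_span)
    \<comment> \<open>Half of \<open>e\<close> pays for folding \<open>g\<close>, the other half for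
      replacing the folded function by \<open>f\<close>.\<close>
    moreover have "\<bar>(\<integral>z. g z \<partial>M k) - (\<integral>z. f z \<partial>M k)\<bar> \<le> e" for k
      using tail[of k] close[OF M, of k] by linarith
    moreover have "\<bar>(\<integral>z. f z \<partial>L) - (\<integral>z. g z \<partial>L)\<bar> \<le> e"
      using n(2) close[OF L] unfolding dist_real_def by linarith
    ultimately show "\<exists>h b. h \<longlonglongrightarrow> b \<and> eventually (\<lambda>k. \<bar>(\<integral>z. g z \<partial>M k) - h k\<bar> \<le> e) sequentially
        \<and> \<bar>b - (\<integral>z. g z \<partial>L)\<bar> \<le> e"
      by (intro exI[of _ "\<lambda>k. \<integral>z. f z \<partial>M k"] exI[of _ "\<integral>z. f z \<partial>L"]) auto
  qed
qed

section \<open>The isotropic Gaussian\<close>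

text \<open>Lebesgue measure is determined by its values on boxes, and a complex box pulls back to a
  product of two intervals.\<close>

lemma lborel_complex: "(lborel :: complex measure) = distr (lborel \<Otimes>\<^sub>M lborel) borel (\<lambda>(x, y). Complex x y)"
proof (rule lborel_eqI)
  have meas [measurable]: "(\<lambda>(x, y). Complex x y) \<in> borel_measurable (lborel \<Otimes>\<^sub>M lborel :: (real \<times> real) measure)"
    unfolding lborel_prod
    by (simp add: case_prod_beta borel_measurable_continuous_onI continuous_on_Complex continuous_intros)
  fix l u :: complex assume "\<And>b. b \<in> Basis \<Longrightarrow> l \<bullet> b \<le> u \<bullet> b"
  from this[of 1] this[of \<i>] have le: "Re l \<le> Re u" "Im l \<le> Im u"
    by (auto simp: Basis_complex_def)
  have "(\<lambda>(x, y). Complex x y) -` box l u = {Re l<..<Re u} \<times> {Im l<..<Im u}"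
    by (auto simp: in_box_complex_iff)
  then have "emeasure (distr (lborel \<Otimes>\<^sub>M lborel) borel (\<lambda>(x, y). Complex x y)) (box l u)
     = emeasure (lborel \<Otimes>\<^sub>M lborel) ({Re l<..<Re u} \<times> {Im l<..<Im u})"
    by (subst emeasure_distr) (auto simp: space_pair_measure)
  also have "\<dots> = ennreal ((Re u - Re l) * (Im u - Im l))"
    using le by (simp add: lborel.emeasure_pair_measure_Times ennreal_mult)
  finally show "emeasure (distr (lborel \<Otimes>\<^sub>M lborel) borel (\<lambda>(x, y). Complex x y)) (box l u)
     = (\<Prod>b\<in>Basis. (u - l) \<bullet> b)"
    by (simp add: Basis_complex_def)
qed simp

text \<open>Variance h/2 per coordinate is forced: twice it is the \<open>h\<close> in the exponent,
  and the two normalising factors sqrt(2 pi h/2) multiply to \<open>pi * h\<close>.\<close>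

lemma iso_gaussian_eq_distr:
  assumes "h > 0"
  defines "N \<equiv> density lborel (normal_density 0 (sqrt (h / 2)))"
  shows "iso_gaussian h = distr (N \<Otimes>\<^sub>M N) borel (\<lambda>(x, y). Complex x y)"
proof -
  have N: "prob_space N" unfolding N_def using assms(1) by (intro prob_space_normal_density) simp
  interpret N: prob_space N by fact
  have meas [measurable]: "(\<lambda>(x, y). Complex x y) \<in> borel_measurable (lborel \<Otimes>\<^sub>M lborel :: (real \<times> real) measure)"
    unfolding lborel_prod
    by (simp add: case_prod_beta borel_measurable_continuous_onI continuous_on_Complex continuous_intros)
  have "exp (- (cmod (Complex x y))\<^sup>2 / h) / (pi * h)
      = normal_density 0 (sqrt (h / 2)) x * normal_density 0 (sqrt (h / 2)) y" for x y
    using assms(1) by (simp add: normal_density_def cmod_power2 exp_add[symmetric] add_divide_distrib diff_divide_distrib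
      real_sqrt_mult[symmetric] mult.commute[of pi] del: real_sqrt_mult)
  then have "iso_gaussian h = distr (density (lborel \<Otimes>\<^sub>M lborel)
      (\<lambda>(x, y). ennreal (normal_density 0 (sqrt (h / 2)) x) * ennreal (normal_density 0 (sqrt (h / 2)) y)))
      borel (\<lambda>(x, y). Complex x y)"
    unfolding iso_gaussian_def
    by (subst lborel_complex, subst density_distr) (auto simp: case_prod_unfold ennreal_mult)
  also have "density (lborel \<Otimes>\<^sub>M lborel)
      (\<lambda>(x, y). ennreal (normal_density 0 (sqrt (h / 2)) x) * ennreal (normal_density 0 (sqrt (h / 2)) y)) = N \<Otimes>\<^sub>M N"
    unfolding N_def
    by (rule pair_measure_density[symmetric])
      (use N N_def in \<open>auto intro: prob_space_imp_sigma_finite sigma_finite_lborel\<close>)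
  finally show ?thesis .
qed

text \<open>Rescaling the variable by \<open>\<sigma>\<close> reduces the integral to the
  characteristic function of the standard normal law.\<close>

lemma char_normal_density:
  assumes "\<sigma> > 0"
  shows "(\<integral>x. cis (u * x) \<partial>density lborel (normal_density 0 \<sigma>)) = exp (- (\<sigma> * u)\<^sup>2 / 2)"
proof -
  have "(\<integral>x. cis (u * x) \<partial>density lborel (normal_density 0 \<sigma>))
      = (\<integral>x. normal_density 0 \<sigma> x *\<^sub>R cis (u * x) \<partial>lborel)"
    by (subst integral_density) (auto intro!: borel_measurable_continuous_onI continuous_intros)
  also have "\<dots> = \<sigma> *\<^sub>R (\<integral>x. normal_density 0 \<sigma> (0 + \<sigma> * x) *\<^sub>R cis (u * (0 + \<sigma> * x)) \<partial>lborel)"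
    using assms by (subst lborel_integral_real_affine[where c = \<sigma> and t = 0]) auto
  also have "\<dots> = (\<integral>x. \<sigma> *\<^sub>R (normal_density 0 \<sigma> (\<sigma> * x) *\<^sub>R cis (u * (\<sigma> * x))) \<partial>lborel)"
    by (subst integral_scaleR_right) simp_all
  also have "\<dots> = (\<integral>x. std_normal_density x *\<^sub>R iexp (\<sigma> * u * x) \<partial>lborel)"
  proof (rule Bochner_Integration.integral_cong[OF refl])
    fix x
    have "\<sigma> * normal_density 0 \<sigma> (\<sigma> * x) = std_normal_density x"
      using assms by (simp add: normal_density_def real_sqrt_mult power_mult_distrib)
    from this[symmetric] show "\<sigma> *\<^sub>R (normal_density 0 \<sigma> (\<sigma> * x) *\<^sub>R cis (u * (\<sigma> * x))) = std_normal_density x *\<^sub>R iexp (\<sigma> * u * x)"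
      by (simp add: cis_conv_exp mult_ac)
  qed
  also have "\<dots> = char std_normal_distribution (\<sigma> * u)"
    unfolding char_def by (subst integral_density) auto
  finally show ?thesis by (simp add: char_std_normal_distribution)
qed

text \<open>Fubini splits the planar integral into two one-dimensional ones; h/4 is half of the
  variance h/2 of a coordinate.\<close>

lemma
  assumes "h > 0"
  shows prob_space_iso_gaussian: "prob_space (iso_gaussian h)"
    and sets_iso_gaussian [simp]: "sets (iso_gaussian h) = sets borel"
    and char_iso_gaussian: "(\<integral>z. cis (w \<bullet> z) \<partial>iso_gaussian h) = exp (- (cmod w)\<^sup>2 * h / 4)"
proof -
  define N where "N = density lborel (normal_density 0 (sqrt (h / 2)))"
  have \<sigma>: "sqrt (h / 2) > 0" using assms by simp
  have eq: "iso_gaussian h = distr (N \<Otimes>\<^sub>M N) borel (\<lambda>(x, y). Complex x y)"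
    unfolding N_def using assms by (rule iso_gaussian_eq_distr)
  have N: "prob_space N" unfolding N_def using \<sigma> by (rule prob_space_normal_density)
  interpret N: prob_space N by fact
  interpret pair_prob_space N N ..
  have sets_N [measurable_cong]: "sets N = sets borel" by (simp add: N_def)
  have meas [measurable]: "(\<lambda>(x, y). Complex x y) \<in> borel_measurable (N \<Otimes>\<^sub>M N)"
  proof -
    have "(\<lambda>(x, y). Complex x y) \<in> borel_measurable (borel \<Otimes>\<^sub>M borel :: (real \<times> real) measure)"
      unfolding borel_prod
      by (simp add: case_prod_beta borel_measurable_continuous_onI continuous_on_Complex continuous_intros)
    then show ?thesis by (simp cong: measurable_cong_sets add: sets_N sets_pair_measure_cong[OF sets_N sets_N])
  qed
  show "sets (iso_gaussian h) = sets borel" by (simp add: iso_gaussian_def)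
  show "prob_space (iso_gaussian h)" unfolding eq by (rule P.prob_space_distr) simp
  have cis_meas [measurable]: "(\<lambda>x. cis (u * x)) \<in> borel_measurable borel" for u
    by (intro borel_measurable_continuous_onI continuous_intros)
  have int: "integrable (N \<Otimes>\<^sub>M N) (\<lambda>(x, y). cis (Re w * x) * cis (Im w * y))"
    by (intro P.integrable_const_bound[where B = 1]) (auto simp: norm_mult)
  have "(\<integral>z. cis (w \<bullet> z) \<partial>iso_gaussian h) = (\<integral>p. (case p of (x, y) \<Rightarrow> cis (Re w * x) * cis (Im w * y)) \<partial>(N \<Otimes>\<^sub>M N))"
    unfolding eq by (subst integral_distr[OF meas measurable_plane_char])
      (auto simp: case_prod_unfold inner_complex_def cis_mult)
  also have "\<dots> = (\<integral>x. \<integral>y. cis (Re w * x) * cis (Im w * y) \<partial>N \<partial>N)"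
    using integral_fst[OF int] by simp
  also have "\<dots> = (\<integral>x. cis (Re w * x) \<partial>N) * (\<integral>y. cis (Im w * y) \<partial>N)"
    by simp
  also have "\<dots> = exp (- (cmod w)\<^sup>2 * h / 4)"
    unfolding N_def char_normal_density[OF \<sigma>] using assms
    by (simp add: cmod_power2 exp_of_real power_mult_distrib exp_add[symmetric] of_real_mult[symmetric] field_simps
      del: of_real_mult)
  finally show "(\<integral>z. cis (w \<bullet> z) \<partial>iso_gaussian h) = exp (- (cmod w)\<^sup>2 * h / 4)" .
qed

section \<open>Central limit theorem\<close>

lemma exp_minus_taylor:
  fixes x :: real assumes "x \<ge> 0"
  shows "\<bar>exp (- x) - (1 - x)\<bar> \<le> x\<^sup>2"
proof -
  have "exp (- x) \<ge> 1 - x" using exp_ge_add_one_self[of "- x"] by simp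
  moreover have "exp (- x) \<le> 1 - x + x\<^sup>2"
  proof -
    have "exp (- x) \<le> 1 / (1 + x)"
      using exp_ge_add_one_self[of x] assms by (simp add: exp_minus inverse_eq_divide frac_le)
    also have "\<dots> \<le> 1 - x + x\<^sup>2"
    proof -
      \<comment> \<open>The product equals 1 + x^3.\<close>
      have "1 \<le> (1 - x + x\<^sup>2) * (1 + x)" using assms by (simp add: algebra_simps power2_eq_square)
      then show ?thesis using assms by (simp add: divide_le_eq)
    qed
    finally show ?thesis .
  qed
  ultimately show ?thesis by linarith
qed

context steinhaus
begin

lemma expectation_Z: "expectation (Z k) = 0"
  using moment[of 1 k] by simp

lemma integrable_Z: "integrable M (\<lambda>\<omega>. Z k \<omega> ^ n)"
  by (intro integrable_const_bound[where B = 1]) (auto simp: norm_power)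

text \<open>Both terms are compared with 1 - |v|^2/4, the expected second-order Taylor polynomial:
  the mean of \<open>Z k\<close> is 0 and that of \<open>(v \<bullet> Z k \<omega>)\<^sup>2\<close>
  is |v|^2/2. The cubic remainder of the imaginary exponential gives the third power,
  \<open>exp_minus_taylor\<close> the fourth.\<close>

lemma char_Z_approx:
  "cmod (expectation (\<lambda>\<omega>. cis (v \<bullet> Z k \<omega>)) - complex_of_real (exp (- (cmod v)\<^sup>2 / 4))) \<le> cmod v ^ 3 + cmod v ^ 4"
proof -
  have quad: "expectation (\<lambda>\<omega>. 1 + \<i> * (v \<bullet> Z k \<omega>) - (v \<bullet> Z k \<omega>)\<^sup>2 / 2) = 1 - (cmod v)\<^sup>2 / 4"
  proof -
    have Z2: "(Re (Z k \<omega>))\<^sup>2 + (Im (Z k \<omega>))\<^sup>2 = 1" for \<omega>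
      using norm_Z[of k \<omega>] by (simp add: cmod_def)
    have in1: "complex_of_real (v \<bullet> Z k \<omega>) = of_real (Re (cnj v * Z k \<omega>))" for \<omega>
      by (simp add: inner_complex_def)
    \<comment> \<open>To be used with |v|^2 for \<open>s\<close> and
      \<open>Re ((cnj v)\<^sup>2 * Z k \<omega> ^ 2)\<close> for \<open>t\<close>; the terms in
      \<open>x\<close> and \<open>t\<close> then have mean zero.\<close>
    have alg: "1 + \<i> * x - complex_of_real ((s + t) / 2 / 2)
        = of_real (1 - s / 4) + \<i> * x - complex_of_real t / 4" for x s t
      by (simp add: field_simps)
    \<comment> \<open>For p = cnj v Z this is (Re p)^2 = (|p|^2 + Re(p^2))/2; the second moment of
      \<open>Z k\<close> removes the oscillating half.\<close>
    have in2: "(v \<bullet> Z k \<omega>)\<^sup>2 = ((cmod v)\<^sup>2 + Re ((cnj v)\<^sup>2 * Z k \<omega> ^ 2)) / 2" for \<omega>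
    proof -
      have "(cmod v)\<^sup>2 = (cmod v)\<^sup>2 * ((Re (Z k \<omega>))\<^sup>2 + (Im (Z k \<omega>))\<^sup>2)" by (simp add: Z2)
      then show ?thesis
        by (simp only: cmod_power2) (simp add: inner_complex_def power2_eq_square algebra_simps)
    qed
    have int1: "integrable M (\<lambda>\<omega>. complex_of_real (Re (cnj v * Z k \<omega>)))"
      using integrable_Z[of k 1] by (intro integrable_of_real integrable_Re integrable_mult_right) simp
    have int2: "integrable M (\<lambda>\<omega>. complex_of_real (Re ((cnj v)\<^sup>2 * Z k \<omega> ^ 2)))"
      by (intro integrable_of_real integrable_Re integrable_mult_right integrable_Z)
    have e1: "expectation (\<lambda>\<omega>. complex_of_real (Re (cnj v * Z k \<omega>))) = 0"
      using integrable_Z[of k 1] expectation_Z[of k]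
      by (simp only: integral_complex_of_real) (subst integral_Re, simp_all)
    have e2: "expectation (\<lambda>\<omega>. complex_of_real (Re ((cnj v)\<^sup>2 * Z k \<omega> ^ 2))) = 0"
      using moment[of 2 k] integrable_Z[of k 2]
      by (simp only: integral_complex_of_real) (subst integral_Re, simp_all)
    have lin: "expectation (\<lambda>\<omega>. c + \<i> * f \<omega> - g \<omega> / 4) = c + \<i> * expectation f - expectation g / 4"
      if "integrable M f" "integrable M g" for c and f g :: "'a \<Rightarrow> complex"
      using that by (simp add: prob_space)
    show ?thesis
      unfolding in2 unfolding in1 alg lin[OF int1 int2] e1 e2 by simp
  qed
  have int_cis: "integrable M (\<lambda>\<omega>. cis (v \<bullet> Z k \<omega>))"
    by (intro integrable_const_bound[where B = 1])
      (auto intro: measurable_compose[OF measurable_Z measurable_plane_char])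
  have int_q: "integrable M (\<lambda>\<omega>. 1 + \<i> * (v \<bullet> Z k \<omega>) - (v \<bullet> Z k \<omega>)\<^sup>2 / 2)"
  proof (intro integrable_const_bound[where B = "1 + cmod v + (cmod v)\<^sup>2"] AE_I2)
    fix \<omega>
    have "\<bar>v \<bullet> Z k \<omega>\<bar> \<le> cmod v" using Cauchy_Schwarz_ineq2[of v "Z k \<omega>"] by simp
    moreover from this have "(v \<bullet> Z k \<omega>)\<^sup>2 \<le> (cmod v)\<^sup>2" by (simp add: abs_le_square_iff[symmetric])
    moreover have "cmod (1 + \<i> * (v \<bullet> Z k \<omega>) - (v \<bullet> Z k \<omega>)\<^sup>2 / 2) \<le> 1 + \<bar>v \<bullet> Z k \<omega>\<bar> + (v \<bullet> Z k \<omega>)\<^sup>2 / 2"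
      by (intro order.trans[OF norm_triangle_ineq4] add_mono order.trans[OF norm_triangle_ineq])
        (auto simp: norm_mult norm_divide norm_power)
    moreover have "(v \<bullet> Z k \<omega>)\<^sup>2 \<ge> 0" by simp
    ultimately show "cmod (1 + \<i> * (v \<bullet> Z k \<omega>) - (v \<bullet> Z k \<omega>)\<^sup>2 / 2) \<le> 1 + cmod v + (cmod v)\<^sup>2"
      by linarith
  qed measurable
  have "cmod (expectation (\<lambda>\<omega>. cis (v \<bullet> Z k \<omega>)) - complex_of_real (1 - (cmod v)\<^sup>2 / 4))
    = cmod (expectation (\<lambda>\<omega>. cis (v \<bullet> Z k \<omega>) - (1 + \<i> * (v \<bullet> Z k \<omega>) - (v \<bullet> Z k \<omega>)\<^sup>2 / 2)))"
    unfolding quad[symmetric] using int_cis int_q by (subst Bochner_Integration.integral_diff) simp_all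
  also have "\<dots> \<le> expectation (\<lambda>\<omega>. cmod v ^ 3)"
  proof (rule norm_integral_le)
    fix \<omega>
    have "cmod (cis (v \<bullet> Z k \<omega>) - (1 + \<i> * (v \<bullet> Z k \<omega>) - (v \<bullet> Z k \<omega>)\<^sup>2 / 2)) \<le> \<bar>v \<bullet> Z k \<omega>\<bar> ^ 3 / 6"
      using iexp_approx1[of "v \<bullet> Z k \<omega>" 2]
      by (simp add: cis_conv_exp numeral_eq_Suc power_mult_distrib field_simps)
    also have "\<dots> \<le> \<bar>v \<bullet> Z k \<omega>\<bar> ^ 3" by simp
    also have "\<dots> \<le> cmod v ^ 3"
      using Cauchy_Schwarz_ineq2[of v "Z k \<omega>"] by (intro power_mono) auto
    finally show "cmod (cis (v \<bullet> Z k \<omega>) - (1 + \<i> * (v \<bullet> Z k \<omega>) - (v \<bullet> Z k \<omega>)\<^sup>2 / 2)) \<le> cmod v ^ 3" .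
  qed (use int_cis int_q in auto)
  finally have 1: "cmod (expectation (\<lambda>\<omega>. cis (v \<bullet> Z k \<omega>)) - complex_of_real (1 - (cmod v)\<^sup>2 / 4)) \<le> cmod v ^ 3"
    by (simp add: prob_space)
  have "cmod (complex_of_real (1 - (cmod v)\<^sup>2 / 4) - complex_of_real (exp (- (cmod v)\<^sup>2 / 4))) = \<bar>exp (- ((cmod v)\<^sup>2 / 4)) - (1 - (cmod v)\<^sup>2 / 4)\<bar>"
    unfolding of_real_diff[symmetric] norm_of_real minus_divide_left by (rule abs_minus_commute)
  also have "\<dots> \<le> ((cmod v)\<^sup>2 / 4)\<^sup>2" by (rule exp_minus_taylor) simp
  also have "\<dots> \<le> cmod v ^ 4" by (simp add: power_divide power_mult[symmetric])
  finally have "cmod (complex_of_real (1 - (cmod v)\<^sup>2 / 4) - complex_of_real (exp (- (cmod v)\<^sup>2 / 4))) \<le> cmod v ^ 4" .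
  with 1 show ?thesis using norm_triangle_le[of "expectation (\<lambda>\<omega>. cis (v \<bullet> Z k \<omega>)) - complex_of_real (1 - (cmod v)\<^sup>2 / 4)"
      "complex_of_real (1 - (cmod v)\<^sup>2 / 4) - complex_of_real (exp (- (cmod v)\<^sup>2 / 4))" "cmod v ^ 3 + cmod v ^ 4"]
    by simp
qed

lemma char_sum:
  assumes "finite J"
  shows "expectation (\<lambda>\<omega>. cis (w \<bullet> (\<Sum>j\<in>J. of_real (a j) * Z j \<omega>)))
    = (\<Prod>j\<in>J. expectation (\<lambda>\<omega>. cis ((of_real (a j) * w) \<bullet> Z j \<omega>)))"
proof -
  have "cis (w \<bullet> (\<Sum>j\<in>J. of_real (a j) * Z j \<omega>)) = (\<Prod>j\<in>J. cis ((of_real (a j) * w) \<bullet> Z j \<omega>))" for \<omega>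
    using assms
  proof induction
    case (insert i F)
    have "w \<bullet> (of_real (a i) * Z i \<omega>) = (of_real (a i) * w) \<bullet> Z i \<omega>"
      by (simp add: inner_complex_def algebra_simps)
    with insert show ?case by (simp add: inner_add_right cis_mult[symmetric])
  qed simp
  moreover have "indep_vars (\<lambda>_. borel) (\<lambda>j \<omega>. cis ((of_real (a j) * w) \<bullet> Z j \<omega>)) J"
    by (rule indep_vars_compose2[OF indep_vars_subset[OF indep]]) (auto intro: measurable_plane_char)
  ultimately show ?thesis
    using assms by (simp only:) (intro indep_vars_lebesgue_integral,
      auto intro!: integrable_const_bound[where B = 1] simp: indep_vars_def)
qed

text \<open>The variables are orthonormal in L^2. The square is expanded over the complex numbers,
  where |S|^2 = S cnj S becomes a combination of characters.\<close>

lemma second_moment_sum: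
  assumes J: "finite J"
  shows "integrable M (\<lambda>\<omega>. (cmod (\<Sum>j\<in>J. of_real (a j) * Z j \<omega>))\<^sup>2)"
    and "expectation (\<lambda>\<omega>. (cmod (\<Sum>j\<in>J. of_real (a j) * Z j \<omega>))\<^sup>2) = (\<Sum>j\<in>J. (a j)\<^sup>2)"
proof -
  have orth: "expectation (\<lambda>\<omega>. Z i \<omega> * cnj (Z j \<omega>)) = (if i = j then 1 else 0)" for i j
  proof (cases "i = j")
    case True
    then show ?thesis using mixed_moment[of j 1 1] by simp
  next
    case False
    \<comment> \<open>Indicator exponents write the product as a monomial over \<open>{i, j}\<close>
      whose two exponents differ at \<open>i\<close>.\<close>
    have "(\<Prod>k\<in>{i, j}. Z k \<omega> ^ of_bool (k = i) * cnj (Z k \<omega>) ^ of_bool (k = j)) = Z i \<omega> * cnj (Z j \<omega>)" for \<omega>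
      using False by simp
    then show ?thesis
      using expectation_monomial[of "{i, j}" "\<lambda>k. of_bool (k = i)" "\<lambda>k. of_bool (k = j)"] False by simp
  qed
  have int: "integrable M (\<lambda>\<omega>. Z i \<omega> * cnj (Z j \<omega>))" for i j
    by (intro integrable_const_bound[where B = 1])
      (auto simp: norm_mult intro!: borel_measurable_times measurable_compose[OF measurable_Z]
        borel_measurable_continuous_onI continuous_intros)
  have eq: "complex_of_real ((cmod (\<Sum>j\<in>J. of_real (a j) * Z j \<omega>))\<^sup>2)
     = (\<Sum>i\<in>J. \<Sum>j\<in>J. of_real (a i * a j) * (Z i \<omega> * cnj (Z j \<omega>)))" for \<omega>
    unfolding complex_norm_square by (simp add: sum_product mult_ac)
  then have *: "(cmod (\<Sum>j\<in>J. of_real (a j) * Z j \<omega>))\<^sup>2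
     = Re (\<Sum>i\<in>J. \<Sum>j\<in>J. of_real (a i * a j) * (Z i \<omega> * cnj (Z j \<omega>)))" for \<omega>
    by (metis Re_complex_of_real)
  have int': "integrable M (\<lambda>\<omega>. \<Sum>i\<in>J. \<Sum>j\<in>J. of_real (a i * a j) * (Z i \<omega> * cnj (Z j \<omega>)))"
    by (intro Bochner_Integration.integrable_sum integrable_mult_right int)
  then show "integrable M (\<lambda>\<omega>. (cmod (\<Sum>j\<in>J. of_real (a j) * Z j \<omega>))\<^sup>2)"
    unfolding * by (rule integrable_Re)
  have "complex_of_real (expectation (\<lambda>\<omega>. (cmod (\<Sum>j\<in>J. of_real (a j) * Z j \<omega>))\<^sup>2))
    = expectation (\<lambda>\<omega>. \<Sum>i\<in>J. \<Sum>j\<in>J. of_real (a i * a j) * (Z i \<omega> * cnj (Z j \<omega>)))"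
    by (simp only: integral_complex_of_real[symmetric] eq)
  also have "\<dots> = (\<Sum>i\<in>J. \<Sum>j\<in>J. of_real (a i * a j) * (if i = j then 1 else 0))"
    using int by (simp only: Bochner_Integration.integral_sum Bochner_Integration.integrable_sum
        integrable_mult_right integral_mult_right_zero orth)
  also have "\<dots> = of_real (\<Sum>j\<in>J. (a j)\<^sup>2)"
    using J by (simp add: power2_eq_square if_distrib cong: if_cong)
  finally show "expectation (\<lambda>\<omega>. (cmod (\<Sum>j\<in>J. of_real (a j) * Z j \<omega>))\<^sup>2) = (\<Sum>j\<in>J. (a j)\<^sup>2)"
    by (simp only: of_real_eq_iff)
qed

text \<open>Lindeberg's replacement: factors of modulus at most 1 are exchanged one at a time for
  Gaussian ones, so the errors add up. The third power of a weight is at most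
  \<open>\<delta>\<close> times its square; so is the fourth, because
  \<open>\<delta> \<le> 1\<close> makes the square itself at most \<open>\<delta>\<close>.\<close>

lemma char_sum_approx:
  assumes J: "finite J" and a: "\<And>j. j \<in> J \<Longrightarrow> \<bar>a j\<bar> \<le> \<delta>" and "\<delta> \<le> 1"
  shows "cmod (expectation (\<lambda>\<omega>. cis (w \<bullet> (\<Sum>j\<in>J. of_real (a j) * Z j \<omega>)))
      - exp (- (cmod w)\<^sup>2 * (\<Sum>j\<in>J. (a j)\<^sup>2) / 4)) \<le> \<delta> * ((cmod w ^ 3 + cmod w ^ 4) * (\<Sum>j\<in>J. (a j)\<^sup>2))"
proof -
  have "exp (- (cmod w)\<^sup>2 * (\<Sum>j\<in>J. (a j)\<^sup>2) / 4)
      = (\<Prod>j\<in>J. exp (- (cmod (of_real (a j) * w))\<^sup>2 / 4))"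
    using J by (simp add: exp_sum[symmetric] norm_mult power_mult_distrib sum_distrib_left
        sum_negf[symmetric] sum_divide_distrib mult_ac)
  then have "cmod (expectation (\<lambda>\<omega>. cis (w \<bullet> (\<Sum>j\<in>J. of_real (a j) * Z j \<omega>)))
      - exp (- (cmod w)\<^sup>2 * (\<Sum>j\<in>J. (a j)\<^sup>2) / 4))
    = cmod ((\<Prod>j\<in>J. expectation (\<lambda>\<omega>. cis ((of_real (a j) * w) \<bullet> Z j \<omega>)))
      - (\<Prod>j\<in>J. complex_of_real (exp (- (cmod (of_real (a j) * w))\<^sup>2 / 4))))"
    by (simp only: char_sum[OF J] of_real_prod)
  also have "\<dots> \<le> (\<Sum>j\<in>J. cmod (expectation (\<lambda>\<omega>. cis ((of_real (a j) * w) \<bullet> Z j \<omega>))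
      - complex_of_real (exp (- (cmod (of_real (a j) * w))\<^sup>2 / 4))))"
  proof (rule norm_prod_diff)
    fix j
    have "cmod (expectation (\<lambda>\<omega>. cis ((of_real (a j) * w) \<bullet> Z j \<omega>))) \<le> expectation (\<lambda>\<omega>. 1)"
      by (rule norm_integral_le)
        (auto intro!: integrable_const_bound[where B = 1] measurable_compose[OF measurable_Z measurable_plane_char])
    then show "cmod (expectation (\<lambda>\<omega>. cis ((of_real (a j) * w) \<bullet> Z j \<omega>))) \<le> 1"
      by (simp add: prob_space)
  qed simp
  also have "\<dots> \<le> (\<Sum>j\<in>J. \<delta> * ((cmod w ^ 3 + cmod w ^ 4) * (a j)\<^sup>2))"
  proof (rule sum_mono)
    fix j assume "j \<in> J"
    then have \<delta>: "\<bar>a j\<bar> \<le> \<delta>" by (rule a)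
    then have "\<bar>a j\<bar> * \<bar>a j\<bar> \<le> \<delta> * 1" using \<open>\<delta> \<le> 1\<close> by (intro mult_mono) auto
    then have "\<bar>a j\<bar> ^ 2 \<le> \<delta>" by (simp add: power2_eq_square)
    then have "\<bar>a j\<bar> ^ 3 \<le> \<delta> * (a j)\<^sup>2 \<and> \<bar>a j\<bar> ^ 4 \<le> \<delta> * (a j)\<^sup>2"
      using mult_right_mono[OF \<delta>, of "(a j)\<^sup>2"] mult_right_mono[of "\<bar>a j\<bar> ^ 2" \<delta> "(a j)\<^sup>2"]
      by (simp add: power3_eq_cube power4_eq_xxxx power2_eq_square mult_ac)
    then have "\<bar>a j\<bar> ^ 3 * cmod w ^ 3 + \<bar>a j\<bar> ^ 4 * cmod w ^ 4
        \<le> \<delta> * (a j)\<^sup>2 * cmod w ^ 3 + \<delta> * (a j)\<^sup>2 * cmod w ^ 4"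
      by (intro add_mono mult_right_mono) auto
    with char_Z_approx[of "of_real (a j) * w" j]
    show "cmod (expectation (\<lambda>\<omega>. cis ((of_real (a j) * w) \<bullet> Z j \<omega>))
      - complex_of_real (exp (- (cmod (of_real (a j) * w))\<^sup>2 / 4)))
      \<le> \<delta> * ((cmod w ^ 3 + cmod w ^ 4) * (a j)\<^sup>2)"
      by (simp add: norm_mult power_mult_distrib exp_of_real[symmetric] algebra_simps)
  qed
  also have "\<dots> = \<delta> * ((cmod w ^ 3 + cmod w ^ 4) * (\<Sum>j\<in>J. (a j)\<^sup>2))"
    by (simp add: sum_distrib_left)
  finally show ?thesis .
qed

text \<open>The variances converge and are thus bounded by some \<open>C\<close>, which serves
  twice: it makes the replacement error vanish with \<open>\<delta>\<close>, and it is the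
  second-moment bound for tightness.\<close>

theorem steinhaus_clt:
  fixes a :: "nat \<Rightarrow> nat \<Rightarrow> real" and J :: "nat \<Rightarrow> nat set"
  assumes J: "\<And>n. finite (J n)" and "h > 0"
    and var: "(\<lambda>n. \<Sum>j\<in>J n. (a n j)\<^sup>2) \<longlonglongrightarrow> h"
    and small: "\<And>\<delta>. \<delta> > 0 \<Longrightarrow> eventually (\<lambda>n. \<forall>j\<in>J n. \<bar>a n j\<bar> \<le> \<delta>) sequentially"
  shows "weak_conv_seq (\<lambda>n. distr M borel (\<lambda>\<omega>. \<Sum>j\<in>J n. of_real (a n j) * Z j \<omega>)) (iso_gaussian h)"
proof -
  obtain C where C: "(\<Sum>j\<in>J n. (a n j)\<^sup>2) \<le> C" for n
    using Bseq_eq_bounded convergent_imp_Bseq[OF convergentI[OF var]] unfolding Bseq_def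
    by (metis abs_le_D1 real_norm_def)
  have C0: "C \<ge> 0" using C[of 0] by (meson order.trans sum_nonneg zero_le_power2)
  show ?thesis
  proof (rule plane_levy_continuity)
    fix w :: complex
    let ?A = "(cmod w ^ 3 + cmod w ^ 4) * C"
    have A0: "?A \<ge> 0" using C0 by simp
    have "(\<lambda>n. expectation (\<lambda>\<omega>. cis (w \<bullet> (\<Sum>j\<in>J n. of_real (a n j) * Z j \<omega>)))
        - complex_of_real (exp (- (cmod w)\<^sup>2 * (\<Sum>j\<in>J n. (a n j)\<^sup>2) / 4))) \<longlonglongrightarrow> 0"
    proof (rule tendstoI)
      fix e :: real assume "e > 0"
      \<comment> \<open>The cap 1 is demanded by \<open>char_sum_approx\<close>; adding 1 to
        \<open>?A\<close> keeps the quotient meaningful when \<open>?A = 0\<close> and makes the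
        final inequality strict.\<close>
      define \<delta> where "\<delta> = min 1 (e / (?A + 1))"
      have \<delta>: "\<delta> > 0" "\<delta> \<le> 1" "\<delta> * ?A < e"
      proof -
        show "\<delta> > 0" using \<open>e > 0\<close> A0 by (simp add: \<delta>_def)
        have "\<delta> * ?A < \<delta> * (?A + 1)" using \<open>\<delta> > 0\<close> by simp
        also have "\<dots> \<le> e / (?A + 1) * (?A + 1)" using A0 by (intro mult_right_mono) (auto simp: \<delta>_def)
        also have "\<dots> = e" using A0 by simp
        finally show "\<delta> * ?A < e" .
      qed (simp add: \<delta>_def)
      show "eventually (\<lambda>n. dist (expectation (\<lambda>\<omega>. cis (w \<bullet> (\<Sum>j\<in>J n. of_real (a n j) * Z j \<omega>)))
        - complex_of_real (exp (- (cmod w)\<^sup>2 * (\<Sum>j\<in>J n. (a n j)\<^sup>2) / 4))) 0 < e) sequentially"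
        using small[OF \<delta>(1)]
      proof eventually_elim
        case (elim n)
        have "\<delta> * ((cmod w ^ 3 + cmod w ^ 4) * (\<Sum>j\<in>J n. (a n j)\<^sup>2)) \<le> \<delta> * ?A"
          using \<delta>(1) C by (intro mult_left_mono) auto
        with char_sum_approx[OF J _ \<delta>(2), of n "a n" w] elim \<delta>(3) show ?case
          by (fastforce simp: dist_norm)
      qed
    qed
    moreover have "(\<lambda>n. complex_of_real (exp (- (cmod w)\<^sup>2 * (\<Sum>j\<in>J n. (a n j)\<^sup>2) / 4)))
      \<longlonglongrightarrow> complex_of_real (exp (- (cmod w)\<^sup>2 * h / 4))"
      by (intro tendsto_intros var) simp
    ultimately have "(\<lambda>n. expectation (\<lambda>\<omega>. cis (w \<bullet> (\<Sum>j\<in>J n. of_real (a n j) * Z j \<omega>))))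
      \<longlonglongrightarrow> complex_of_real (exp (- (cmod w)\<^sup>2 * h / 4))"
      using tendsto_add by fastforce
    then show "(\<lambda>n. \<integral>z. cis (w \<bullet> z) \<partial>distr M borel (\<lambda>\<omega>. \<Sum>j\<in>J n. of_real (a n j) * Z j \<omega>))
      \<longlonglongrightarrow> (\<integral>z. cis (w \<bullet> z) \<partial>iso_gaussian h)"
      using \<open>h > 0\<close> by (simp add: integral_distr measurable_plane_char char_iso_gaussian)
  qed (use J C second_moment_sum[OF J] \<open>h > 0\<close> in
      \<open>auto simp: prob_space_distr prob_space_iso_gaussian integrable_distr_eq integral_distr\<close>)
qed

end

section \<open>Increments of the process\<close>

text \<open>Independence says that the joint law is the product of the marginals, and these laws are
  the same on \<open>M\<close> as on its image. This characterisation is where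
  \<open>I \<noteq> {}\<close> enters.\<close>

lemma (in prob_space) indep_vars_distrI:
  assumes X: "X \<in> measurable M N" and Y: "\<And>i. i \<in> I \<Longrightarrow> Y i \<in> measurable N (M' i)"
    and indep: "indep_vars M' (\<lambda>i \<omega>. Y i (X \<omega>)) I" and "I \<noteq> {}"
  shows "prob_space.indep_vars (distr M N X) M' Y I"
proof -
  interpret D: prob_space "distr M N X" by (rule prob_space_distr[OF X])
  have XY: "(\<lambda>\<omega>. Y i (X \<omega>)) \<in> measurable M (M' i)" if "i \<in> I" for i
    using measurable_compose[OF X Y[OF that]] .
  have "distr (distr M N X) (PiM I M') (\<lambda>x. \<lambda>i\<in>I. Y i x) = distr M (PiM I M') (\<lambda>\<omega>. \<lambda>i\<in>I. Y i (X \<omega>))"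
    using X Y by (subst distr_distr) (auto intro!: measurable_restrict simp: comp_def)
  also have "\<dots> = PiM I (\<lambda>i. distr M (M' i) (\<lambda>\<omega>. Y i (X \<omega>)))"
    using indep_vars_iff_distr_eq_PiM'[OF \<open>I \<noteq> {}\<close> XY] indep by simp
  also have "\<dots> = PiM I (\<lambda>i. distr (distr M N X) (M' i) (Y i))"
    using X Y by (intro PiM_cong) (auto simp: distr_distr comp_def)
  finally show ?thesis
    using D.indep_vars_iff_distr_eq_PiM'[OF \<open>I \<noteq> {}\<close>, of Y M'] Y by simp
qed

context steinhaus
begin

lemma indep_vars_block_sums:
  assumes "disjoint_family_on J L"
  shows "indep_vars (\<lambda>_. borel) (\<lambda>i \<omega>. \<Sum>j\<in>J i. of_real (a j) * Z j \<omega>) L"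
proof -
  have "indep_vars (\<lambda>i. PiM (J i) (\<lambda>_. borel)) (\<lambda>i \<omega>. restrict (\<lambda>j. Z j \<omega>) (J i)) L"
    using indep _ assms by (rule indep_vars_restrict) simp
  then have "indep_vars (\<lambda>_. borel) (\<lambda>i \<omega>. \<Sum>j\<in>J i. of_real (a j) * restrict (\<lambda>j. Z j \<omega>) (J i) j) L"
    by (rule indep_vars_compose2) measurable
  then show ?thesis by simp
qed

text \<open>A test function composed with \<open>G\<close> is again continuous and depends only on
  \<open>K\<close>, so equidistribution applies to it. Questions about the time average thereby
  become questions on \<open>M\<close>.\<close>

theorem time_avg_law_flow:
  fixes G :: "(nat \<Rightarrow> complex) \<Rightarrow> 'b::metric_space"
  assumes K: "finite K"
    and E: "\<And>q :: nat \<Rightarrow> int. (\<Sum>k\<in>K. of_int (q k) * E k) = 0 \<Longrightarrow> \<forall>k\<in>K. q k = 0"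
    and G: "continuous_on UNIV G"
    and dep: "\<And>x y. (\<And>k. k \<in> K \<Longrightarrow> x k = y k) \<Longrightarrow> G x = G y"
  shows "time_avg_law (\<lambda>t. G (\<lambda>k. cis (- (t * E k)))) (distr M borel (\<lambda>\<omega>. G (\<lambda>k. Z k \<omega>)))"
proof -
  have meas: "(\<lambda>\<omega>. G (\<lambda>k. Z k \<omega>)) \<in> borel_measurable M"
    using measurable_Z_vector borel_measurable_continuous_onI[OF G] by (rule measurable_compose)
  show ?thesis unfolding time_avg_law_def
  proof (intro conjI allI impI)
    fix g :: "'b \<Rightarrow> real" assume "continuous_on UNIV g \<and> bounded (range g)"
    then have g: "continuous_on UNIV g" by simp
    have cont: "continuous_on UNIV (\<lambda>x. g (G x))"
      by (rule continuous_on_compose2[OF g G]) simp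
    have "((\<lambda>T. (LINT t:{0..T}|lborel. g (G (\<lambda>k. cis (- (t * E k))))) / T)
        \<longlongrightarrow> expectation (\<lambda>\<omega>. g (G (\<lambda>k. Z k \<omega>)))) at_top"
    proof (rule weyl_equidistribution[OF K E cont])
      show "g (G x) = g (G y)" if "\<And>k. k \<in> K \<Longrightarrow> x k = y k" for x y
        using dep[of x y] that by simp
    qed
    then show "((\<lambda>T. (LINT t:{0..T}|lborel. g (G (\<lambda>k. cis (- (t * E k))))) / T)
        \<longlongrightarrow> (\<integral>x. g x \<partial>distr M borel (\<lambda>\<omega>. G (\<lambda>k. Z k \<omega>)))) at_top"
      by (simp add: integral_distr[OF meas borel_measurable_continuous_onI[OF g]])
  qed (simp_all add: prob_space_distr[OF meas])
qed

end

lemma W_proc_increment: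
  assumes "s \<le> s'"
  shows "W_proc d E N s' t - W_proc d E N s t =
    (\<Sum>j = nat \<lfloor>real N * s\<rfloor> + 1..nat \<lfloor>real N * s'\<rfloor>.
      complex_of_real (d N j / sqrt (\<Sum>k = 1..N. (d N k)\<^sup>2)) * cis (- (t * E N j)))"
proof -
  define a where "a = nat \<lfloor>real N * s\<rfloor>"
  define b where "b = nat \<lfloor>real N * s'\<rfloor>"
  have "a \<le> b" unfolding a_def b_def using assms by (intro nat_mono floor_mono mult_left_mono) auto
  then have split: "{1..b} = {1..a} \<union> {a + 1..b}" by auto
  have "(\<Sum>j = 1..b. f j) - (\<Sum>j = 1..a. f j) = (\<Sum>j = a + 1..b. f j)" for f :: "nat \<Rightarrow> complex"
    unfolding split by (subst sum.union_disjoint) auto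
  then show ?thesis
    unfolding W_proc_def a_def[symmetric] b_def[symmetric] diff_divide_distrib[symmetric]
    by (simp add: sum_divide_distrib cis_conv_exp)
qed

text \<open>A discrete intermediate value principle, used to find the cell of a subdivision that
  contains a given index.\<close>

lemma exists_step_interval:
  fixes f :: "nat \<Rightarrow> nat"
  assumes "f 0 < j" "j \<le> f n"
  obtains i where "i < n" "f i < j" "j \<le> f (Suc i)"
proof -
  have "\<exists>i<n. f i < j \<and> j \<le> f (Suc i)"
    using assms(2)
  proof (induction n)
    case 0
    with assms(1) show ?case by simp
  next
    case (Suc n)
    then show ?case by (meson less_Suc_eq linorder_not_le)
  qed
  with that show ?thesis by blast
qed

text \<open>A weight is dominated by the variance of the block of length h / n containing it.\<close>
lemma weights_negligible:
  fixes d :: "nat \<Rightarrow> nat \<Rightarrow> real"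
  assumes lin: "\<And>s h. s \<ge> 0 \<Longrightarrow> h \<ge> 0 \<Longrightarrow> s + h \<le> smax \<Longrightarrow>
      (\<lambda>N. (\<Sum>k = nat \<lfloor>real N * s\<rfloor> + 1..nat \<lfloor>real N * (s + h)\<rfloor>. (d N k)\<^sup>2)
         / (\<Sum>k = 1..N. (d N k)\<^sup>2)) \<longlonglongrightarrow> h"
    and "s \<ge> 0" "h > 0" "s + h \<le> smax" "\<delta> > 0"
  shows "eventually (\<lambda>N. \<forall>j\<in>{nat \<lfloor>real N * s\<rfloor> + 1..nat \<lfloor>real N * (s + h)\<rfloor>}.
    \<bar>d N j / sqrt (\<Sum>k = 1..N. (d N k)\<^sup>2)\<bar> \<le> \<delta>) sequentially"
proof -
  \<comment> \<open>The target is \<open>\<delta>\<^sup>2\<close> because relative variances are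
    squares of normalised weights.\<close>
  obtain n :: nat where n: "n > 0" "h / n < \<delta>\<^sup>2"
  proof -
    obtain n :: nat where n: "h / \<delta>\<^sup>2 < n" using reals_Archimedean2 by blast
    have "h / \<delta>\<^sup>2 > 0" using \<open>h > 0\<close> \<open>\<delta> > 0\<close> by simp
    with n have "real n > 0" by linarith
    with n \<open>\<delta> > 0\<close> have "h / n < \<delta>\<^sup>2" by (simp add: field_simps)
    with \<open>real n > 0\<close> that[of n] show ?thesis by simp
  qed
  define p where "p i = s + h / n * real i" for i
  have p_Suc: "p (Suc i) = p i + h / n" for i by (simp add: p_def algebra_simps add_divide_distrib)
  have p: "p i \<ge> 0" "p i + h / n \<le> smax" if "i < n" for i
  proof -
    show "p i \<ge> 0" using assms by (simp add: p_def)
    have "p (Suc i) \<le> p n"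
      using that assms unfolding p_def by (intro add_left_mono mult_left_mono) auto
    moreover have "p n = s + h" using n(1) by (simp add: p_def)
    ultimately show "p i + h / n \<le> smax" using p_Suc[of i] \<open>s + h \<le> smax\<close> by simp
  qed
  have "eventually (\<lambda>N. (\<Sum>k = nat \<lfloor>real N * p i\<rfloor> + 1..nat \<lfloor>real N * p (Suc i)\<rfloor>. (d N k)\<^sup>2)
         / (\<Sum>k = 1..N. (d N k)\<^sup>2) < \<delta>\<^sup>2) sequentially" if "i < n" for i
    unfolding p_Suc using lin[OF p(1)[OF that] _ p(2)[OF that]] n assms
    by (intro order_tendstoD(2)) auto
  \<comment> \<open>The number \<open>n\<close> of blocks does not depend on \<open>N\<close>, so
    finitely many thresholds cover all weights, whose number does grow.\<close>
  then have "eventually (\<lambda>N. \<forall>i\<in>{..<n}. (\<Sum>k = nat \<lfloor>real N * p i\<rfloor> + 1..nat \<lfloor>real N * p (Suc i)\<rfloor>. (d N k)\<^sup>2)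
         / (\<Sum>k = 1..N. (d N k)\<^sup>2) < \<delta>\<^sup>2) sequentially"
    by (intro eventually_ball_finite) auto
  then show ?thesis
  proof eventually_elim
    case (elim N)
    show ?case
    proof
      fix j assume j: "j \<in> {nat \<lfloor>real N * s\<rfloor> + 1..nat \<lfloor>real N * (s + h)\<rfloor>}"
      have "p 0 = s" "p n = s + h" using n(1) by (simp_all add: p_def)
      with j have "nat \<lfloor>real N * p 0\<rfloor> < j" "j \<le> nat \<lfloor>real N * p n\<rfloor>" by auto
      then obtain i where i: "i < n" "nat \<lfloor>real N * p i\<rfloor> < j" "j \<le> nat \<lfloor>real N * p (Suc i)\<rfloor>"
        by (rule exists_step_interval[of "\<lambda>i. nat \<lfloor>real N * p i\<rfloor>"])
      define V where "V = (\<Sum>k = 1..N. (d N k)\<^sup>2)"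
      have V: "V \<ge> 0" by (simp add: V_def sum_nonneg)
      have "(d N j)\<^sup>2 \<le> (\<Sum>k = nat \<lfloor>real N * p i\<rfloor> + 1..nat \<lfloor>real N * p (Suc i)\<rfloor>. (d N k)\<^sup>2)"
        using i by (intro member_le_sum) auto
      then have "(d N j)\<^sup>2 / V \<le> (\<Sum>k = nat \<lfloor>real N * p i\<rfloor> + 1..nat \<lfloor>real N * p (Suc i)\<rfloor>. (d N k)\<^sup>2) / V"
        using V by (rule divide_right_mono)
      also have "\<dots> < \<delta>\<^sup>2" using elim i(1) by (auto simp: V_def)
      finally have "(d N j / sqrt V)\<^sup>2 \<le> \<delta>\<^sup>2" using V by (simp add: power_divide)
      then show "\<bar>d N j / sqrt (\<Sum>k = 1..N. (d N k)\<^sup>2)\<bar> \<le> \<delta>"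
        unfolding V_def using \<open>\<delta> > 0\<close> by (simp only: abs_le_square_iff[symmetric])
    qed
  qed
qed

text \<open>Increment vectors are padded by 0 beyond \<open>m\<close>, so that joint laws for every
  \<open>m\<close> live on the single type \<open>nat => complex\<close>.\<close>

theorem theorem3:
  fixes smax :: real
    and NB :: "nat \<Rightarrow> nat"
    and E d :: "nat \<Rightarrow> nat \<Rightarrow> real"
  assumes smax_pos: "smax > 0"
    and NB_ge: "\<And>N. NB N \<ge> nat \<lfloor>real N * smax\<rfloor>"
    and lin_indep: "\<And>N (q :: nat \<Rightarrow> rat).
          (\<Sum>k = 1..NB N. of_rat (q k) * E N k) = 0 \<Longrightarrow> \<forall>k\<in>{1..NB N}. q k = 0"
    and d_pos: "\<And>N k. k \<in> {1..NB N} \<union> {1..N} \<Longrightarrow> d N k > 0"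
    and cond_a: "\<exists>q::real. q > 1 \<and>
          (\<lambda>N. (\<Sum>k = 1..N. d N k powr (2 * q)) / (\<Sum>k = 1..N. (d N k)\<^sup>2) powr q) \<longlonglongrightarrow> 0"
    and cond_b: "\<And>s h. s \<ge> 0 \<Longrightarrow> h \<ge> 0 \<Longrightarrow> s + h \<le> smax \<Longrightarrow>
          (\<lambda>N. (\<Sum>k = nat \<lfloor>real N * s\<rfloor> + 1..nat \<lfloor>real N * (s + h)\<rfloor>. (d N k)\<^sup>2)
                 / (\<Sum>k = 1..N. (d N k)\<^sup>2)) \<longlonglongrightarrow> h"
  shows
    "(\<forall>(m::nat) (s :: nat \<Rightarrow> real). m \<ge> 1 \<and> 0 \<le> s 0 \<and> s m \<le> smax \<and> (\<forall>i<m. s i < s (Suc i)) \<longrightarrow>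
        (\<forall>N. \<exists>\<mu> :: (nat \<Rightarrow> complex) measure.
            time_avg_law (\<lambda>t i. if i < m then W_proc d E N (s (Suc i)) t - W_proc d E N (s i) t else 0) \<mu>
          \<and> prob_space.indep_vars \<mu> (\<lambda>_. borel) (\<lambda>i x. x i) {..<m}))
   \<and> (\<forall>s h. 0 \<le> s \<and> 0 < h \<and> s + h \<le> smax \<longrightarrow>
        (\<exists>\<nu> :: nat \<Rightarrow> complex measure.
            (\<forall>N. time_avg_law (\<lambda>t. W_proc d E N (s + h) t - W_proc d E N s t) (\<nu> N))
          \<and> weak_conv_seq \<nu> (iso_gaussian h)))"
proof -
  obtain M and Z :: "nat \<Rightarrow> (nat \<Rightarrow> real) \<Rightarrow> complex" where "steinhaus M Z" by (rule steinhaus_exists)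
  then interpret steinhaus M Z .
  define J where "J N s s' = {nat \<lfloor>real N * s\<rfloor> + 1..nat \<lfloor>real N * s'\<rfloor>}" for N and s s' :: real
  define a where "a N j = d N j / sqrt (\<Sum>k = 1..N. (d N k)\<^sup>2)" for N j
  have increment: "W_proc d E N s' t - W_proc d E N s t = (\<Sum>j\<in>J N s s'. of_real (a N j) * cis (- (t * E N j)))"
    if "s \<le> s'" for N s s' t
    unfolding J_def a_def using that by (rule W_proc_increment)
  \<comment> \<open>Every energy occurring in an increment belongs to the independent family; this
    rests on \<open>NB_ge\<close>.\<close>
  have J_sub: "J N s s' \<subseteq> {1..NB N}" if "s' \<le> smax" for N s s'
  proof -
    have "nat \<lfloor>real N * s'\<rfloor> \<le> nat \<lfloor>real N * smax\<rfloor>"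
      using that by (intro nat_mono floor_mono mult_left_mono) auto
    with NB_ge[of N] show ?thesis by (auto simp: J_def)
  qed
  \<comment> \<open>Characters have integer exponents, so rational independence is applied to
    integer relations.\<close>
  have indep_E: "\<forall>k\<in>{1..NB N}. q k = 0" if "(\<Sum>k = 1..NB N. of_int (q k) * E N k) = 0" for N and q :: "nat \<Rightarrow> int"
    using lin_indep[where q = "\<lambda>k. of_int (q k)"] that by simp
  show ?thesis
  proof (intro conjI allI impI)
    fix m :: nat and s :: "nat \<Rightarrow> real" and N
    assume "m \<ge> 1 \<and> 0 \<le> s 0 \<and> s m \<le> smax \<and> (\<forall>i<m. s i < s (Suc i))"
    then have "m \<ge> 1" and sm: "s m \<le> smax" and less: "\<And>i. i < m \<Longrightarrow> s i < s (Suc i)" by auto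
    have mono: "s i \<le> s k" if "i \<le> k" "k \<le> m" for i k
      using that by (induction k rule: dec_induct) (auto intro: less_imp_le less order.trans[OF _ less_imp_le[OF less]])
    \<comment> \<open>All increments form one continuous map of the phases, so a single application
      of \<open>time_avg_law_flow\<close> yields their joint law.\<close>
    define G :: "(nat \<Rightarrow> complex) \<Rightarrow> nat \<Rightarrow> complex"
      where "G x i = (if i < m then \<Sum>j\<in>J N (s i) (s (Suc i)). of_real (a N j) * x j else 0)" for x i
    have J_sub_i: "J N (s i) (s (Suc i)) \<subseteq> {1..NB N}" if "i < m" for i
      using mono[of "Suc i" m] that sm by (intro J_sub) auto
    have G_cont: "continuous_on UNIV G"
    proof (rule continuous_on_coordinatewise_then_product)
      fix i show "continuous_on UNIV (\<lambda>x. G x i)"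
        unfolding G_def by (cases "i < m") (auto intro!: continuous_intros)
    qed
    have "time_avg_law (\<lambda>t. G (\<lambda>k. cis (- (t * E N k)))) (distr M borel (\<lambda>\<omega>. G (\<lambda>k. Z k \<omega>)))"
    proof (rule time_avg_law_flow[OF _ indep_E G_cont])
      fix x y :: "nat \<Rightarrow> complex" assume xy: "\<And>k. k \<in> {1..NB N} \<Longrightarrow> x k = y k"
      have "x j = y j" if "i < m" "j \<in> J N (s i) (s (Suc i))" for i j
        using that J_sub_i[of i] by (intro xy) auto
      then show "G x = G y" unfolding G_def by (intro ext) simp
    qed simp_all
    moreover have "(\<lambda>t. G (\<lambda>k. cis (- (t * E N k))))
      = (\<lambda>t i. if i < m then W_proc d E N (s (Suc i)) t - W_proc d E N (s i) t else 0)"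
      unfolding G_def by (intro ext) (simp add: increment less less_imp_le)
    moreover have "prob_space.indep_vars (distr M borel (\<lambda>\<omega>. G (\<lambda>k. Z k \<omega>))) (\<lambda>_. borel) (\<lambda>i x. x i) {..<m}"
    proof (rule indep_vars_distrI)
      show "(\<lambda>\<omega>. G (\<lambda>k. Z k \<omega>)) \<in> borel_measurable M"
        using measurable_Z_vector borel_measurable_continuous_onI[OF G_cont] by (rule measurable_compose)
      \<comment> \<open>Each block starts one index after its left endpoint, so adjacent blocks
        share no energy.\<close>
      have "J N (s i) (s (Suc i)) \<inter> J N (s k) (s (Suc k)) = {}" if "i < k" "k < m" for i k
      proof -
        have "nat \<lfloor>real N * s (Suc i)\<rfloor> \<le> nat \<lfloor>real N * s k\<rfloor>"
          using mono[of "Suc i" k] that by (intro nat_mono floor_mono mult_left_mono) auto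
        then show ?thesis by (auto simp: J_def)
      qed
      then have "disjoint_family_on (\<lambda>i. J N (s i) (s (Suc i))) {..<m}"
        unfolding disjoint_family_on_def by (metis Int_commute lessThan_iff linorder_neqE_nat)
      then have "indep_vars (\<lambda>_. borel) (\<lambda>i \<omega>. \<Sum>j\<in>J N (s i) (s (Suc i)). of_real (a N j) * Z j \<omega>) {..<m}"
        by (rule indep_vars_block_sums)
      then show "indep_vars (\<lambda>_. borel) (\<lambda>i \<omega>. G (\<lambda>k. Z k \<omega>) i) {..<m}"
        by (subst indep_vars_cong[OF refl _ refl]) (auto simp: G_def)
    qed (use \<open>m \<ge> 1\<close> in \<open>auto intro!: borel_measurable_continuous_onI simp: lessThan_empty_iff\<close>)
    ultimately show "\<exists>\<mu> :: (nat \<Rightarrow> complex) measure.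
        time_avg_law (\<lambda>t i. if i < m then W_proc d E N (s (Suc i)) t - W_proc d E N (s i) t else 0) \<mu>
        \<and> prob_space.indep_vars \<mu> (\<lambda>_. borel) (\<lambda>i x. x i) {..<m}"
      by auto
  next
    fix s h assume "0 \<le> s \<and> 0 < h \<and> s + h \<le> smax"
    then have s: "0 \<le> s" "0 < h" "s + h \<le> smax" by auto
    define \<nu> where "\<nu> N = distr M borel (\<lambda>\<omega>. \<Sum>j\<in>J N s (s + h). of_real (a N j) * Z j \<omega>)" for N
    have law: "time_avg_law (\<lambda>t. W_proc d E N (s + h) t - W_proc d E N s t) (\<nu> N)" for N
    proof -
      define G where "G x = (\<Sum>j\<in>J N s (s + h). of_real (a N j) * x j)" for x :: "nat \<Rightarrow> complex"
      have "time_avg_law (\<lambda>t. G (\<lambda>k. cis (- (t * E N k)))) (distr M borel (\<lambda>\<omega>. G (\<lambda>k. Z k \<omega>)))"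
      proof (rule time_avg_law_flow[OF _ indep_E])
        show "continuous_on UNIV G" unfolding G_def by (auto intro!: continuous_intros)
        fix x y :: "nat \<Rightarrow> complex" assume "\<And>k. k \<in> {1..NB N} \<Longrightarrow> x k = y k"
        then show "G x = G y" unfolding G_def using J_sub[OF s(3), of N s] by (auto intro!: sum.cong)
      qed simp_all
      then show ?thesis using s(2) by (simp add: G_def \<nu>_def increment)
    qed
    have "weak_conv_seq \<nu> (iso_gaussian h)"
      unfolding \<nu>_def
    proof (rule steinhaus_clt)
      have "(a N j)\<^sup>2 = (d N j)\<^sup>2 / (\<Sum>k = 1..N. (d N k)\<^sup>2)" for N j
        by (simp add: a_def power_divide sum_nonneg)
      then show "(\<lambda>N. \<Sum>j\<in>J N s (s + h). (a N j)\<^sup>2) \<longlonglongrightarrow> h"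
        using cond_b[of s h] s by (simp add: J_def sum_divide_distrib)
      show "eventually (\<lambda>N. \<forall>j\<in>J N s (s + h). \<bar>a N j\<bar> \<le> \<delta>) sequentially" if "\<delta> > 0" for \<delta>
        unfolding J_def a_def using cond_b s that by (rule weights_negligible)
    qed (use s in \<open>auto simp: J_def\<close>)
    with law show "\<exists>\<nu> :: nat \<Rightarrow> complex measure.
        (\<forall>N. time_avg_law (\<lambda>t. W_proc d E N (s + h) t - W_proc d E N s t) (\<nu> N))
        \<and> weak_conv_seq \<nu> (iso_gaussian h)"
      by blast
  qed
qed

end
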